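(* Let $X$ and $Y$ be Banach spaces such that $C_b^G(X)$ contains a bump function on $X$ and $C_b^F(Y)$ contains a bump function on $Y$. Then the following assertions are equivalent. (1) There exists an isomorphism $\Phi:C_b^G(X)\to C_b^F(Y)$ such that $\|\Phi(f)\|_\infty=\|f\|_\infty$ and $\|(\Phi(f))'\|_\infty=\|f'\|_\infty$ for all $f\in C_b^G(X)$. (2) $X$ and $Y$ are isometrically isomorphic and of finite dimension.
   Context: All spaces are real. For a Banach space $X$, $C_b^G(X)$ (resp. $C_b^F(X)$) is the space of all bounded, Lipschitz, everywhere Gâteaux differentiable (resp. everywhere Fréchet differentiable) functions $f:X\to\mathbb{R}$, with norm $\|f\|=\max(\|f\|_\infty,\|f'\|_\infty)$, where $\|f\|_\infty=\sup_{x\in X}|f(x)|$, $f'(x)\in X^*$ is the (Gâteaux, resp. Fréchet) derivative, and $\|f'\|_\infty=\sup_{x\in X}\|f'(x)\|$ (which equals the best Lipschitz constant of $f$). These are Banach spaces. An isomorphism is a linear bijective isomorphism of Banach spaces. A bump function on $X$ is a nonnegative continuous function $b:X\to\mathbb{R}$, not identically $0$, with bounded support. *)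

theory Defs
  imports "HOL-Analysis.Analysis"
begin

definition has_gateaux_derivative ::
  "('a::real_normed_vector \<Rightarrow> 'b::real_normed_vector) \<Rightarrow> ('a \<Rightarrow> 'b) \<Rightarrow> 'a \<Rightarrow> bool"
  where "has_gateaux_derivative f D x \<longleftrightarrow>
    bounded_linear D \<and> (\<forall>h. ((\<lambda>t::real. (f (x + t *\<^sub>R h) - f x) /\<^sub>R t) \<longlongrightarrow> D h) (at 0))"

definition gateaux_differentiable ::
  "('a::real_normed_vector \<Rightarrow> 'b::real_normed_vector) \<Rightarrow> 'a \<Rightarrow> bool"
  where "gateaux_differentiable f x \<longleftrightarrow> (\<exists>D. has_gateaux_derivative f D x)"

definition gateaux_derivative ::
  "('a::real_normed_vector \<Rightarrow> 'b::real_normed_vector) \<Rightarrow> 'a \<Rightarrow> 'a \<Rightarrow> 'b"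
  where "gateaux_derivative f x = (SOME D. has_gateaux_derivative f D x)"

lemma gateaux_derivative_eq:
  assumes "has_gateaux_derivative f D x"
  shows "gateaux_derivative f x = D"
proof -
  have "has_gateaux_derivative f (gateaux_derivative f x) x"
    unfolding gateaux_derivative_def using assms by (rule someI[of "\<lambda>D. has_gateaux_derivative f D x"])
  with assms show ?thesis
    unfolding has_gateaux_derivative_def
    by (metis (no_types, lifting) ext tendsto_unique trivial_limit_at)
qed

definition CbG :: "('a::real_normed_vector \<Rightarrow> real) set"
  where "CbG = {f. bounded (range f) \<and> (\<exists>L. L-lipschitz_on UNIV f) \<and>
                   (\<forall>x. gateaux_differentiable f x)}"

definition CbF :: "('a::real_normed_vector \<Rightarrow> real) set"
  where "CbF = {f. bounded (range f) \<and> (\<exists>L. L-lipschitz_on UNIV f) \<and>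
                   (\<forall>x. f differentiable (at x))}"

text \<open>The suprema below are taken in the reals, so they are meaningful only for functions for
  which they are bounded above; this is the case on \<^const>\<open>CbG\<close> and \<^const>\<open>CbF\<close>, respectively.\<close>

definition sup_norm :: "('a \<Rightarrow> real) \<Rightarrow> real"
  where "sup_norm f = (SUP x. \<bar>f x\<bar>)"

definition gateaux_deriv_norm :: "('a::real_normed_vector \<Rightarrow> real) \<Rightarrow> real"
  where "gateaux_deriv_norm f = (SUP x. onorm (gateaux_derivative f x))"

definition frechet_deriv_norm :: "('a::real_normed_vector \<Rightarrow> real) \<Rightarrow> real"
  where "frechet_deriv_norm f = (SUP x. onorm (frechet_derivative f (at x)))"

definition CbG_norm :: "('a::real_normed_vector \<Rightarrow> real) \<Rightarrow> real"
  where "CbG_norm f = max (sup_norm f) (gateaux_deriv_norm f)"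

definition CbF_norm :: "('a::real_normed_vector \<Rightarrow> real) \<Rightarrow> real"
  where "CbF_norm f = max (sup_norm f) (frechet_deriv_norm f)"

text \<open>Linear homeomorphisms between function spaces given by carrier sets \<open>A\<close>, \<open>B\<close>, closed under
  pointwise addition and scaling, with norms \<open>nA\<close>, \<open>nB\<close>. Values of \<open>\<Phi>\<close> outside \<open>A\<close> are irrelevant.\<close>

definition function_space_isomorphism ::
  "('a \<Rightarrow> real) set \<Rightarrow> (('a \<Rightarrow> real) \<Rightarrow> real) \<Rightarrow> ('b \<Rightarrow> real) set \<Rightarrow> (('b \<Rightarrow> real) \<Rightarrow> real) \<Rightarrow>
   (('a \<Rightarrow> real) \<Rightarrow> 'b \<Rightarrow> real) \<Rightarrow> bool"
  where "function_space_isomorphism A nA B nB \<Phi> \<longleftrightarrow>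
    bij_betw \<Phi> A B \<and>
    (\<forall>f\<in>A. \<forall>g\<in>A. \<Phi> (\<lambda>x. f x + g x) = (\<lambda>y. \<Phi> f y + \<Phi> g y)) \<and>
    (\<forall>c. \<forall>f\<in>A. \<Phi> (\<lambda>x. c * f x) = (\<lambda>y. c * \<Phi> f y)) \<and>
    (\<exists>K. \<forall>f\<in>A. nB (\<Phi> f) \<le> K * nA f) \<and>
    (\<exists>K. \<forall>f\<in>A. nA f \<le> K * nB (\<Phi> f))"

definition bump_function :: "('a::real_normed_vector \<Rightarrow> real) \<Rightarrow> bool"
  where "bump_function b \<longleftrightarrow>
    continuous_on UNIV b \<and> (\<forall>x. 0 \<le> b x) \<and> (\<exists>x. b x \<noteq> 0) \<and> bounded (closure {x. b x \<noteq> 0})"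

definition isometric_isomorphism ::
  "('a::real_normed_vector \<Rightarrow> 'b::real_normed_vector) \<Rightarrow> bool"
  where "isometric_isomorphism T \<longleftrightarrow> linear T \<and> bij T \<and> (\<forall>x. norm (T x) = norm x)"

definition finite_dimensional :: "'a::real_vector itself \<Rightarrow> bool"
  where "finite_dimensional _ \<longleftrightarrow> (\<exists>B::'a set. finite B \<and> span B = UNIV)"

end

theory Submission
  imports Defs
begin

text \<open>
  An isomorphism \<open>\<Phi>\<close> preserving both norms maps the constant \<open>1\<close> to a constant \<open>\<plusminus>1\<close>, so up to sign
  it is unital. Bumps shrinking to a point \<open>x\<close> have images whose peaks shrink to a point \<open>S x\<close>, and
  \<open>\<Phi> f (S x) = f x\<close>; the same applies to the inverse. Since functionals attaining the norm can be
  approximated by bounded smooth functions with Lipschitz constant one, \<open>S\<close> is an isometry, and it is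
  affine by the Mazur--Ulam theorem. Hence every function in \<^const>\<open>CbG\<close> on the first space is
  Frechet differentiable, which fails in infinite dimension: a sum of bumps concentrated near points
  \<open>2\<^sup>-\<^sup>n e\<^sub>n\<close> with separated unit vectors \<open>e\<^sub>n\<close> is Gateaux but not Frechet differentiable at the
  origin. Conversely, a Lipschitz function on a finite-dimensional space is Frechet differentiable
  wherever it is Gateaux differentiable, because the unit ball is compact.
\<close>

subsection \<open>Gateaux derivatives\<close>

text \<open>Both derivative norms are best Lipschitz constants, so the two notions of derivative can
  be kept out of the comparison of the spaces: what an isomorphism preserves is the bounds
  \<open>\<bar>f x\<bar> \<le> M\<close> and the Lipschitz bounds. No product or lattice operation
  is known to be preserved. Once the constant one is fixed, the sup norm tells which functions take
  values in the unit interval, but it does not see distances. These come from the Lipschitz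
  constants, and this is why the given bumps are first rescaled to every centre and radius
  \<open>r\<close> with Lipschitz constant \<open>C/r\<close>, where \<open>C\<close> is independent
  of both: the peak sets of the images then have diameter at most a multiple of \<open>r\<close>,
  and completeness supplies the limit point. The point map is built from bumps alone. To test that
  it does not increase distances, the target class has to contain \<open>CbF\<close>, which holds in
  both directions because \<open>CbF \<subseteq> CbG\<close>.\<close>

lemma has_gateaux_derivative_iff_DERIV:
  fixes f :: "'a::real_normed_vector \<Rightarrow> real"
  shows "has_gateaux_derivative f D x \<longleftrightarrow>
    bounded_linear D \<and> (\<forall>h. ((\<lambda>t. f (x + t *\<^sub>R h)) has_real_derivative D h) (at 0))"
  by (simp add: has_gateaux_derivative_def DERIV_def divide_inverse mult.commute)

lemma has_derivative_imp_has_gateaux_derivative: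
  fixes f :: "'a::real_normed_vector \<Rightarrow> real"
  assumes "(f has_derivative D) (at x)"
  shows "has_gateaux_derivative f D x"
proof -
  interpret bounded_linear D
    using assms by (rule has_derivative_bounded_linear)
  have "((\<lambda>t. f (x + t *\<^sub>R h)) has_derivative (\<lambda>t. D (t *\<^sub>R h))) (at 0)" for h
    by (rule has_derivative_compose[where f = "\<lambda>t. x + t *\<^sub>R h"])
       (auto intro!: derivative_eq_intros assms)
  then show ?thesis
    by (auto simp: has_gateaux_derivative_iff_DERIV has_field_derivative_def scaleR mult.commute
        bounded_linear_axioms mult_commute_abs)
qed

lemma DERIV_along_line:
  fixes f :: "'a::real_normed_vector \<Rightarrow> real"
  assumes "has_gateaux_derivative f D (x + s *\<^sub>R h)"
  shows "((\<lambda>t. f (x + t *\<^sub>R h)) has_real_derivative D h) (at s)"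
proof -
  have "((\<lambda>t. f ((x + s *\<^sub>R h) + t *\<^sub>R h)) has_real_derivative D h) (at 0)"
    using assms by (simp add: has_gateaux_derivative_iff_DERIV)
  then show ?thesis
    using DERIV_shift[of "\<lambda>t. f (x + t *\<^sub>R h)" "D h" 0 s] by (simp add: algebra_simps)
qed

lemma has_gateaux_derivative_cong_eventually:
  fixes f g :: "'a::real_normed_vector \<Rightarrow> real"
  assumes "has_gateaux_derivative f D x" and "\<forall>\<^sub>F y in nhds x. f y = g y"
  shows "has_gateaux_derivative g D x"
proof -
  have "((\<lambda>t. g (x + t *\<^sub>R h)) has_real_derivative D h) (at 0)" for h
  proof -
    have "filterlim (\<lambda>t::real. x + t *\<^sub>R h) (nhds (x + 0 *\<^sub>R h)) (nhds 0)"
      by (intro tendsto_intros filterlim_ident)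
    then have "\<forall>\<^sub>F t::real in nhds 0. f (x + t *\<^sub>R h) = g (x + t *\<^sub>R h)"
      using assms(2) by (auto dest!: eventually_compose_filterlim simp: o_def)
    then show ?thesis
      using assms(1) by (subst DERIV_cong_ev[symmetric]) (auto simp: has_gateaux_derivative_iff_DERIV)
  qed
  then show ?thesis
    using assms(1) by (simp add: has_gateaux_derivative_iff_DERIV)
qed

lemma gateaux_differentiable_compose_affine:
  fixes f :: "'a::real_normed_vector \<Rightarrow> real"
  assumes "gateaux_differentiable f (a + k *\<^sub>R x)"
    and "(\<phi> has_real_derivative d) (at (f (a + k *\<^sub>R x)))"
  shows "gateaux_differentiable (\<lambda>y. \<phi> (f (a + k *\<^sub>R y))) x"
proof -
  obtain D where D: "has_gateaux_derivative f D (a + k *\<^sub>R x)"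
    using assms(1) by (auto simp: gateaux_differentiable_def)
  then interpret bounded_linear D
    by (simp add: has_gateaux_derivative_def)
  have "((\<lambda>t. f ((a + k *\<^sub>R x) + t *\<^sub>R k *\<^sub>R h)) has_real_derivative D (k *\<^sub>R h)) (at 0)" for h
    using D by (simp only: has_gateaux_derivative_iff_DERIV)
  then have "((\<lambda>t. f (a + k *\<^sub>R (x + t *\<^sub>R h))) has_real_derivative k * D h) (at 0)" for h
    by (simp add: algebra_simps scaleR)
  then have "((\<lambda>t. \<phi> (f (a + k *\<^sub>R (x + t *\<^sub>R h)))) has_real_derivative d * (k * D h)) (at 0)" for h
    by (rule DERIV_chain2[rotated]) (simp add: assms(2))
  moreover have "bounded_linear (\<lambda>h. d * (k * D h))"
    by (intro bounded_linear_const_mult bounded_linear_axioms)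
  ultimately show ?thesis
    by (auto simp: gateaux_differentiable_def has_gateaux_derivative_iff_DERIV)
qed

section \<open>Derivative norms as Lipschitz constants, sup norms as pointwise bounds\<close>

lemma onorm_le_lipschitz:
  fixes f :: "'a::real_normed_vector \<Rightarrow> real"
  assumes D: "has_gateaux_derivative f D x" and L: "L-lipschitz_on UNIV f"
  shows "onorm D \<le> L"
proof (rule onorm_bound)
  show "0 \<le> L" using L by (rule lipschitz_on_nonneg)
  fix h
  have lim: "((\<lambda>t. norm ((f (x + t *\<^sub>R h) - f x) / t)) \<longlongrightarrow> norm (D h)) (at 0)"
    using D by (intro tendsto_norm) (simp add: has_gateaux_derivative_iff_DERIV DERIV_def)
  moreover have "\<forall>\<^sub>F t in at 0. norm ((f (x + t *\<^sub>R h) - f x) / t) \<le> L * norm h"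
    unfolding eventually_at_filter
  proof (rule always_eventually, safe)
    fix t :: real assume "t \<noteq> 0"
    have "\<bar>f (x + t *\<^sub>R h) - f x\<bar> \<le> L * norm (t *\<^sub>R h)"
      using lipschitz_onD[OF L, of "x + t *\<^sub>R h" x] by (simp add: dist_norm)
    then show "norm ((f (x + t *\<^sub>R h) - f x) / t) \<le> L * norm h"
      using \<open>t \<noteq> 0\<close> by (simp add: field_simps)
  qed
  ultimately show "norm (D h) \<le> L * norm h"
    by (rule tendsto_upperbound) simp
qed

lemma CbG_has_derivative:
  "f \<in> CbG \<Longrightarrow> has_gateaux_derivative f (gateaux_derivative f x) x"
  by (metis (no_types, lifting) CbG_def gateaux_derivative_eq gateaux_differentiable_def mem_Collect_eq)

text \<open>The mean value theorem on the segment from \<open>x\<close> to \<open>y\<close> needs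
  derivatives along that line only, so Gateaux differentiability suffices. From here on the
  derivative norm is handled through Lipschitz bounds.\<close>

lemma CbG_deriv_norm_le_iff:
  assumes "f \<in> CbG" and "0 \<le> K"
  shows "gateaux_deriv_norm f \<le> K \<longleftrightarrow> K-lipschitz_on UNIV f"
proof
  assume K: "K-lipschitz_on UNIV f"
  show "gateaux_deriv_norm f \<le> K"
    unfolding gateaux_deriv_norm_def
    by (rule cSUP_least) (auto intro!: onorm_le_lipschitz[OF _ K] CbG_has_derivative assms)
next
  assume K: "gateaux_deriv_norm f \<le> K"
  obtain L where L: "L-lipschitz_on UNIV f"
    using assms by (auto simp: CbG_def)
  have "bdd_above (range (\<lambda>x. onorm (gateaux_derivative f x)))"
    by (rule bdd_aboveI[of _ L]) (auto intro!: onorm_le_lipschitz[OF _ L] CbG_has_derivative assms)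
  then have on: "onorm (gateaux_derivative f x) \<le> K" for x
    using K unfolding gateaux_deriv_norm_def by (meson UNIV_I cSUP_upper order_trans)
  have "\<bar>f y - f x\<bar> \<le> K * norm (y - x)" for x y
  proof -
    define h where "h = y - x"
    have der: "((\<lambda>t. f (x + t *\<^sub>R h)) has_real_derivative gateaux_derivative f (x + t *\<^sub>R h) h) (at t)" for t
      by (intro DERIV_along_line CbG_has_derivative assms)
    obtain z :: real where "f (x + 1 *\<^sub>R h) - f (x + 0 *\<^sub>R h) = (1 - 0) * gateaux_derivative f (x + z *\<^sub>R h) h"
      using MVT2[of 0 1 "\<lambda>t. f (x + t *\<^sub>R h)", OF _ der] by auto
    then have "\<bar>f y - f x\<bar> = norm (gateaux_derivative f (x + z *\<^sub>R h) h)"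
      by (simp add: h_def)
    also have "\<dots> \<le> onorm (gateaux_derivative f (x + z *\<^sub>R h)) * norm h"
      using CbG_has_derivative[OF assms(1), of "x + z *\<^sub>R h"]
      by (intro onorm) (simp add: has_gateaux_derivative_def)
    also have "\<dots> \<le> K * norm h"
      by (intro mult_right_mono on) simp
    finally show ?thesis by (simp add: h_def)
  qed
  then show "K-lipschitz_on UNIV f"
    using assms(2) by (intro lipschitz_onI) (auto simp: dist_norm)
qed

lemma CbF_subset_CbG: "CbF \<subseteq> (CbG :: ('a::real_normed_vector \<Rightarrow> real) set)"
  by (auto simp: CbF_def CbG_def gateaux_differentiable_def differentiable_def
      dest: has_derivative_imp_has_gateaux_derivative)

lemma CbF_deriv_norm: "f \<in> CbF \<Longrightarrow> frechet_deriv_norm f = gateaux_deriv_norm f"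
  unfolding frechet_deriv_norm_def gateaux_deriv_norm_def
  by (intro SUP_cong refl arg_cong[where f = onorm])
     (auto simp: CbF_def frechet_derivative_works
       intro!: gateaux_derivative_eq[symmetric] has_derivative_imp_has_gateaux_derivative)

lemma sup_norm_le_iff:
  assumes "bounded (range f)"
  shows "sup_norm f \<le> M \<longleftrightarrow> (\<forall>x. \<bar>f x\<bar> \<le> M)"
proof -
  obtain B where "\<And>x. \<bar>f x\<bar> \<le> B"
    using assms by (auto simp: bounded_iff)
  then have "bdd_above (range (\<lambda>x. \<bar>f x\<bar>))"
    by (intro bdd_aboveI[of _ B]) auto
  then show ?thesis
    by (simp add: sup_norm_def cSUP_le_iff)
qed

lemma gateaux_deriv_norm_nonneg:
  assumes "f \<in> CbG" shows "0 \<le> gateaux_deriv_norm f"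
proof -
  obtain L where L: "L-lipschitz_on UNIV f"
    using assms by (auto simp: CbG_def)
  have "bdd_above (range (\<lambda>x. onorm (gateaux_derivative f x)))"
    by (rule bdd_aboveI[of _ L]) (auto intro!: onorm_le_lipschitz[OF _ L] CbG_has_derivative assms)
  moreover have "0 \<le> onorm (gateaux_derivative f 0)"
    using CbG_has_derivative[OF assms] by (simp add: has_gateaux_derivative_def onorm_pos_le)
  ultimately show ?thesis
    unfolding gateaux_deriv_norm_def by (meson UNIV_I cSUP_upper order_trans)
qed

subsection \<open>Norming functionals\<close>

text \<open>Positive homogeneity is stated as one inequality, which is easy to check for infima; the
  converse follows on rescaling by \<open>1/c\<close>.\<close>

definition sublinear :: "('a::real_vector \<Rightarrow> real) \<Rightarrow> bool"
  where "sublinear p \<longleftrightarrow> (\<forall>x y. p (x + y) \<le> p x + p y) \<and> (\<forall>c>0. \<forall>x. p (c *\<^sub>R x) \<le> c * p x) \<and> p 0 = 0"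

lemma sublinear_add: "sublinear p \<Longrightarrow> p (x + y) \<le> p x + p y"
  by (simp add: sublinear_def)

lemma sublinear_zero: "sublinear p \<Longrightarrow> p 0 = 0"
  by (simp add: sublinear_def)

lemma sublinear_scaleR_le: "sublinear p \<Longrightarrow> 0 < c \<Longrightarrow> p (c *\<^sub>R x) \<le> c * p x"
  by (simp add: sublinear_def)

lemma sublinear_scaleR:
  assumes "sublinear p" "0 \<le> c"
  shows "p (c *\<^sub>R x) = c * p x"
proof (cases "c = 0")
  case False
  then have c: "0 < c" using assms(2) by simp
  have "p ((1/c) *\<^sub>R c *\<^sub>R x) \<le> 1/c * p (c *\<^sub>R x)"
    using c by (intro sublinear_scaleR_le assms) simp
  then have "c * p x \<le> p (c *\<^sub>R x)"
    using c by (simp add: field_simps)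
  with sublinear_scaleR_le[OF assms(1) c, of x] show ?thesis by simp
qed (simp add: sublinear_zero assms)

lemma sublinear_minus_ge: "sublinear p \<Longrightarrow> - p (- x) \<le> p x"
  using sublinear_add[of p x "- x"] sublinear_zero[of p] by simp

lemma sublinear_norm: "sublinear norm"
  by (simp add: sublinear_def norm_triangle_ineq)

text \<open>The reduction step of Hahn-Banach: \<open>q x\<close> is the infimum of
  \<open>p (x + t *\<^sub>R v) - t * p v\<close> over \<open>t \<ge> 0\<close>, and
  \<open>t = 1\<close> at \<open>- v\<close> gives the last inequality. A minimal sublinear
  functional coincides with its \<open>q\<close>, hence is odd at every \<open>v\<close>.\<close>

lemma sublinear_odd_minorant:
  assumes p: "sublinear p"
  obtains q where "sublinear q" "\<And>x. q x \<le> p x" "q (- v) \<le> - p v"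
proof -
  define g where "g x t = p (x + t *\<^sub>R v) - t * p v" for x t
  define q where "q x = (INF t\<in>{0..}. g x t)" for x
  have "- p (- x) \<le> g x t" if "0 \<le> t" for x t
    using sublinear_add[OF p, of "x + t *\<^sub>R v" "- x"] sublinear_scaleR[OF p that, of v]
    by (simp add: g_def)
  then have bdd: "bdd_below (g x ` {0..})" for x
    by (intro bdd_belowI[of _ "- p (- x)"]) auto
  have q_le: "q x \<le> g x t" if "0 \<le> t" for x t
    unfolding q_def using that by (intro cINF_lower bdd) auto
  have le_q: "c \<le> q x" if "\<And>t. 0 \<le> t \<Longrightarrow> c \<le> g x t" for c x
    unfolding q_def using that by (intro cINF_greatest) auto
  have "q (x + y) \<le> q x + q y" for x y
  proof -
    have "q (x + y) \<le> g x s + g y t" if "0 \<le> s" "0 \<le> t" for s t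
      using q_le[of "s + t" "x + y"] that
        sublinear_add[OF p, of "x + s *\<^sub>R v" "y + t *\<^sub>R v"]
      by (simp add: g_def algebra_simps)
    then have "q (x + y) - g x s \<le> q y" if "0 \<le> s" for s
      using that by (intro le_q) (simp add: algebra_simps)
    then have "q (x + y) - q y \<le> q x"
      by (intro le_q) (simp add: algebra_simps)
    then show ?thesis by simp
  qed
  moreover have "q (c *\<^sub>R x) \<le> c * q x" if "0 < c" for c x
  proof -
    \<comment> \<open>The parameter scales with the vector:
      \<open>g (c *\<^sub>R x) (c * t) = c * g x t\<close>.\<close>
    have "q (c *\<^sub>R x) / c \<le> g x t" if "0 \<le> t" for t
      using q_le[of "c * t" "c *\<^sub>R x"] that \<open>0 < c\<close> sublinear_scaleR[OF p, of c "x + t *\<^sub>R v"]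
      by (simp add: g_def field_simps)
    then have "q (c *\<^sub>R x) / c \<le> q x"
      by (rule le_q)
    then show ?thesis using that by (simp add: field_simps)
  qed
  moreover have "q 0 = 0"
  proof -
    have "g 0 t = 0" if "0 \<le> t" for t
      using that by (simp add: g_def sublinear_scaleR[OF p])
    then show ?thesis
      by (intro antisym le_q) (use q_le[of 0 0] in auto)
  qed
  ultimately have "sublinear q" by (simp add: sublinear_def)
  moreover have "q x \<le> p x" for x
    using q_le[of 0 x] by (simp add: g_def)
  moreover have "q (- v) \<le> - p v"
    using q_le[of 1 "- v"] sublinear_zero[OF p] by (simp add: g_def)
  ultimately show ?thesis by (rule that)
qed

text \<open>Subadditivity of the infimum needs the chain: of two members \<open>p\<close> and
  \<open>q\<close> the smaller one lies below both, so it bounds the value at \<open>x + y\<close>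
  by \<open>p x + q y\<close>. The common bound \<open>r\<close> keeps the infima finite, from below
  by \<open>- r (- x)\<close>.\<close>

lemma sublinear_INF_chain:
  assumes "C \<noteq> {}" and C: "\<And>p. p \<in> C \<Longrightarrow> sublinear p \<and> (\<forall>x. p x \<le> r x)"
    and chain: "\<And>p q. p \<in> C \<Longrightarrow> q \<in> C \<Longrightarrow> p \<le> q \<or> q \<le> p"
  shows "sublinear (\<lambda>x. INF p\<in>C. p x)" and "p \<in> C \<Longrightarrow> (INF p\<in>C. p x) \<le> p x"
proof -
  define u where "u x = (INF p\<in>C. p x)" for x
  have "- r (- x) \<le> p x" if "p \<in> C" for p x
    using C[OF that] sublinear_minus_ge[of p x] by (smt (verit))
  then have "bdd_below ((\<lambda>p. p x) ` C)" for x
    by (intro bdd_belowI[of _ "- r (- x)"]) auto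
  then have u_le: "u x \<le> p x" if "p \<in> C" for p x
    unfolding u_def using that by (intro cINF_lower)
  then show "p \<in> C \<Longrightarrow> (INF p\<in>C. p x) \<le> p x"
    by (simp add: u_def)
  have le_u: "c \<le> u x" if "\<And>p. p \<in> C \<Longrightarrow> c \<le> p x" for c x
    unfolding u_def using that assms(1) by (intro cINF_greatest)
  have "u (x + y) \<le> u x + u y" for x y
  proof -
    have "u (x + y) \<le> p x + q y" if pq: "p \<in> C" "q \<in> C" for p q
    proof -
      obtain m where "m \<in> C" "m \<le> p" "m \<le> q"
        using chain[OF pq] pq by blast
      then have "u (x + y) \<le> m x + m y" "m x \<le> p x" "m y \<le> q y"
        using u_le[of m "x + y"] C[of m] sublinear_add[of m x y] by (auto simp: le_fun_def)
      then show ?thesis by simp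
    qed
    then have "u (x + y) - p x \<le> u y" if "p \<in> C" for p
      using that by (intro le_u) (metis add.commute diff_le_eq)
    then have "u (x + y) - u y \<le> u x"
      by (intro le_u) (simp add: algebra_simps)
    then show ?thesis by simp
  qed
  moreover have "u (c *\<^sub>R x) \<le> c * u x" if "0 < c" for c x
  proof -
    have "u (c *\<^sub>R x) / c \<le> p x" if "p \<in> C" for p
      using u_le[OF that, of "c *\<^sub>R x"] \<open>0 < c\<close> C[OF that] sublinear_scaleR[of p c x]
      by (simp add: field_simps)
    then have "u (c *\<^sub>R x) / c \<le> u x"
      by (rule le_u)
    then show ?thesis using that by (simp add: field_simps)
  qed
  moreover have "u 0 = 0"
  proof -
    obtain p where "p \<in> C" using assms(1) by blast
    then show ?thesis
      using u_le[of p 0] le_u[of 0 0] C sublinear_zero by (metis order_antisym order_refl)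
  qed
  ultimately show "sublinear (\<lambda>x. INF p\<in>C. p x)"
    by (simp add: sublinear_def u_def)
qed

text \<open>Zorn's lemma for the reversed order gives a minimal sublinear \<open>m\<close> below
  \<open>p\<close>. Minimality makes \<open>m\<close> odd, and oddness turns the inequalities of
  sublinearity into equalities.\<close>

lemma sublinear_imp_linear_minorant:
  assumes "sublinear p"
  obtains f where "linear f" "\<And>x. f x \<le> p x"
proof -
  define A where "A = {q. sublinear q \<and> (\<forall>x. q x \<le> p x)}"
  have "partial_order_on A (relation_of (\<lambda>a b. b \<le> a) A)"
    by (rule partial_order_on_relation_ofI) auto
  moreover have "\<exists>u\<in>A. \<forall>a\<in>C. u \<le> a" if C: "C \<in> Chains (relation_of (\<lambda>a b. b \<le> a) A)" for C
  proof (cases "C = {}")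
    case True
    then show ?thesis using assms by (auto simp: A_def)
  next
    case False
    have CA: "sublinear q \<and> (\<forall>x. q x \<le> p x)" if "q \<in> C" for q
      using C that by (auto simp: Chains_def relation_of_def A_def)
    have ch: "q \<le> q' \<or> q' \<le> q" if "q \<in> C" "q' \<in> C" for q q'
      using C that by (auto simp: Chains_def relation_of_def)
    note inf = sublinear_INF_chain[OF False CA ch]
    obtain q where "q \<in> C" using False by blast
    then have "(INF q\<in>C. q x) \<le> p x" for x
      using inf(2)[of q x] CA[of q] order_trans by blast
    then have "(\<lambda>x. INF q\<in>C. q x) \<in> A"
      using inf(1) by (simp add: A_def)
    moreover have "\<forall>a\<in>C. (\<lambda>x. INF q\<in>C. q x) \<le> a"
      using inf(2) by (simp add: le_fun_def)
    ultimately show ?thesis by blast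
  qed
  ultimately obtain m where m: "m \<in> A" and min: "\<And>a. a \<in> A \<Longrightarrow> a \<le> m \<Longrightarrow> a = m"
    using predicate_Zorn[of A "\<lambda>a b. b \<le> a"] by blast
  have sub: "sublinear m" using m by (simp add: A_def)
  have odd: "m (- v) = - m v" for v
  proof -
    obtain q where q: "sublinear q" "\<And>x. q x \<le> m x" "q (- v) \<le> - m v"
      using sublinear_odd_minorant[OF sub] by blast
    then have "q \<in> A" "q \<le> m"
      using m order_trans by (auto simp: A_def le_fun_def) blast
    then have "q = m" by (rule min)
    then show ?thesis
      using q(3) sublinear_minus_ge[OF sub, of "- v"] by simp
  qed
  have "m (x + y) = m x + m y" for x y
    using sublinear_add[OF sub, of x y] sublinear_add[OF sub, of "x + y" "- y"] odd[of y] by simp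
  moreover have "m (c *\<^sub>R x) = c * m x" for c x
  proof (cases "0 \<le> c")
    case False
    then have "m ((- c) *\<^sub>R x) = - c * m x"
      by (intro sublinear_scaleR sub) simp
    then show ?thesis using odd[of "c *\<^sub>R x"] by simp
  qed (simp add: sublinear_scaleR sub)
  ultimately have "linear m" by (intro linearI) auto
  then show ?thesis using m that by (auto simp: A_def)
qed

text \<open>The reduction step is applied once to the norm in the direction \<open>x\<close> before
  passing to a linear minorant; this forces \<open>f (- x) \<le> - norm x\<close>, that is, the norm
  is attained at \<open>x\<close>.\<close>

lemma norming_functional:
  fixes x :: "'a::real_normed_vector"
  obtains f where "linear f" "\<And>y. \<bar>f y\<bar> \<le> norm y" "f x = norm x"
proof -
  obtain q where q: "sublinear q" "\<And>y. q y \<le> norm y" "q (- x) \<le> - norm x"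
    using sublinear_odd_minorant[OF sublinear_norm] by blast
  then obtain f where f: "linear f" "\<And>y. f y \<le> q y"
    using sublinear_imp_linear_minorant by blast
  have le: "f y \<le> norm y" for y
    using f(2)[of y] q(2)[of y] by simp
  have "\<bar>f y\<bar> \<le> norm y" for y
    using le[of y] le[of "- y"] by (simp add: linear_neg[OF f(1)])
  moreover have "f x = norm x"
    using f(2)[of "- x"] q(3) le[of x] by (simp add: linear_neg[OF f(1)])
  ultimately show ?thesis using f(1) that by blast
qed

subsection \<open>Compactness and dimension\<close>

text \<open>A vector \<open>b\<close> outside the closed set \<open>span S\<close> has positive
  distance \<open>d\<close> from it, so its coefficient in a vector of norm at most \<open>r\<close>
  is at most \<open>r/d\<close> in absolute value. The ball of the larger span thus lies in the sum
  of a compact segment and a compact ball of \<open>span S\<close>. Compact balls make a span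
  closed, since convergent sequences are bounded.\<close>

lemma compact_cball_Int_span:
  fixes S :: "'a::real_normed_vector set"
  assumes "finite S"
  shows "compact (cball 0 r \<inter> span S)" and "closed (span S)"
proof -
  have closed_span: "closed (span S)" if cpt: "\<And>r. compact (cball 0 r \<inter> span S)" for S :: "'a set"
    unfolding closed_sequential_limits
  proof safe
    fix s l assume s: "\<forall>n. s n \<in> span S" "s \<longlonglongrightarrow> l"
    then obtain B where "\<And>n. norm (s n) \<le> B"
      by (meson Bseq_def convergentI convergent_imp_Bseq)
    then have "\<forall>n. s n \<in> cball 0 B \<inter> span S"
      using s(1) by simp
    then show "l \<in> span S"
      using compact_imp_closed[OF cpt[of B]] s(2) unfolding closed_sequential_limits by blast
  qed
  have "\<forall>r. compact (cball 0 r \<inter> span S)"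
    using assms
  proof (induction S)
    case empty
    have "cball 0 r \<inter> {0} = (if 0 \<le> r then {0::'a} else {})" for r by auto
    then show ?case by simp
  next
    case (insert b S)
    show ?case
    proof (cases "b \<in> span S")
      case True
      then show ?thesis using insert.IH by (simp add: span_redundant)
    next
      case False
      define d where "d = infdist b (span S)"
      have cl: "closed (span S)" using insert.IH by (intro closed_span) simp
      then have d: "d > 0"
        unfolding d_def using False
        by (metis infdist_pos_not_in_closed span_0 empty_iff)
      have coord: "\<bar>c\<bar> * d \<le> norm (c *\<^sub>R b + s)" if "s \<in> span S" for c s
      proof (cases "c = 0")
        case c: False
        have "d \<le> dist b (- ((1/c) *\<^sub>R s))"
          unfolding d_def by (intro infdist_le span_neg span_scale that)
        also have "\<dots> = norm ((1/c) *\<^sub>R (c *\<^sub>R b + s))"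
          using c by (simp add: dist_norm algebra_simps)
        also have "\<dots> = norm (c *\<^sub>R b + s) / \<bar>c\<bar>" by simp
        finally show ?thesis using c by (simp add: field_simps)
      qed simp
      show ?thesis
      proof
        fix r
        define K where "K = {x + y | x y. x \<in> (\<lambda>c. c *\<^sub>R b) ` {- (r/d)..r/d} \<and>
          y \<in> cball 0 (r + r/d * norm b) \<inter> span S}"
        have "compact K"
          unfolding K_def using insert.IH
          by (intro compact_sums compact_continuous_image continuous_intros) auto
        moreover have "cball 0 r \<inter> span (insert b S) = cball 0 r \<inter> K"
        proof (intro equalityI subsetI)
          fix x assume x: "x \<in> cball 0 r \<inter> span (insert b S)"
          then obtain c where c: "x - c *\<^sub>R b \<in> span S"
            by (auto simp: span_insert)
          then have "\<bar>c\<bar> * d \<le> r"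
            using coord[OF c, of c] x by simp
          then have cr: "\<bar>c\<bar> \<le> r/d" using d by (simp add: field_simps)
          have "norm (x - c *\<^sub>R b) \<le> norm x + \<bar>c\<bar> * norm b"
            using norm_triangle_ineq4[of x "c *\<^sub>R b"] by simp
          also have "\<dots> \<le> r + r/d * norm b"
            using x cr by (intro add_mono mult_right_mono) auto
          finally have "x - c *\<^sub>R b \<in> cball 0 (r + r/d * norm b) \<inter> span S" using c by simp
          moreover have "x = c *\<^sub>R b + (x - c *\<^sub>R b)" by simp
          moreover have "c \<in> {- (r/d)..r/d}" using cr by auto
          ultimately have "x \<in> K" unfolding K_def by blast
          then show "x \<in> cball 0 r \<inter> K" using x by simp
        next
          fix x assume "x \<in> cball 0 r \<inter> K"
          moreover have "K \<subseteq> span (insert b S)"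
            unfolding K_def
            by (auto intro!: span_add span_scale intro: span_base subsetD[OF span_mono[of S "insert b S"]])
          ultimately show "x \<in> cball 0 r \<inter> span (insert b S)" by blast
        qed
        ultimately show "compact (cball 0 r \<inter> span (insert b S))"
          by (simp add: closed_Int_compact)
      qed
    qed
  qed
  then show "compact (cball 0 r \<inter> span S)" and "closed (span S)"
    using closed_span by auto
qed

lemma finite_dimensional_imp_compact_cball:
  assumes "finite_dimensional TYPE('a::real_normed_vector)"
  shows "compact (cball (0::'a) r)"
  using assms compact_cball_Int_span(1) unfolding finite_dimensional_def by (metis Int_UNIV_right)

lemma riesz_lemma:
  fixes S :: "'a::real_normed_vector set"
  assumes "finite S" "span S \<noteq> UNIV"
  obtains e where "norm e = 1" "\<And>s. s \<in> span S \<Longrightarrow> 1/2 \<le> norm (e - s)"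
proof -
  obtain x where x: "x \<notin> span S" using assms(2) by blast
  define d where "d = infdist x (span S)"
  have ne: "span S \<noteq> {}" using span_0 by blast
  have d: "d > 0"
    unfolding d_def using compact_cball_Int_span(2)[OF assms(1)] x ne
    by (intro infdist_pos_not_in_closed)
  \<comment> \<open>A point of the span within twice the distance exists although a nearest point is
    not claimed; the factor 2 becomes the bound \<open>1/2\<close> after normalisation.\<close>
  have "(INF s\<in>span S. dist x s) < 2 * d"
    using d ne by (simp add: d_def infdist_def)
  then obtain s0 where s0: "s0 \<in> span S" "dist x s0 < 2 * d"
    using ne by (subst (asm) cINF_less_iff) auto
  define k where "k = norm (x - s0)"
  have k: "k > 0" "k < 2 * d" using x s0 by (auto simp: k_def dist_norm)
  have "norm ((1/k) *\<^sub>R (x - s0)) = 1"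
    using k by (simp add: k_def)
  moreover have "1/2 \<le> norm ((1/k) *\<^sub>R (x - s0) - s)" if s: "s \<in> span S" for s
  proof -
    have "d \<le> dist x (s0 + k *\<^sub>R s)"
      unfolding d_def by (intro infdist_le span_add span_scale s s0)
    also have "\<dots> = norm (k *\<^sub>R ((1/k) *\<^sub>R (x - s0) - s))"
      using k by (simp add: dist_norm algebra_simps)
    also have "\<dots> = k * norm ((1/k) *\<^sub>R (x - s0) - s)" using k by simp
    finally have "d \<le> k * norm ((1/k) *\<^sub>R (x - s0) - s)" .
    moreover have "k * (1/2) < d" using k by simp
    ultimately have "k * (1/2) < k * norm ((1/k) *\<^sub>R (x - s0) - s)" by linarith
    then show ?thesis using k by simp
  qed
  ultimately show ?thesis by (rule that)
qed

lemma infinite_dimensional_separated_sequence: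
  assumes "\<not> finite_dimensional TYPE('a::real_normed_vector)"
  obtains e :: "nat \<Rightarrow> 'a::real_normed_vector" where "\<And>n. norm (e n) = 1" "\<And>m n. m \<noteq> n \<Longrightarrow> 1/2 \<le> norm (e m - e n)"
proof -
  have "\<exists>e::nat \<Rightarrow> 'a. \<forall>n. norm (e n) = 1 \<and> (\<forall>m<n. 1/2 \<le> norm (e n - e m))"
  proof (rule dependent_wellorder_choice)
    fix n :: nat and f :: "nat \<Rightarrow> 'a"
    have "span (f ` {..<n}) \<noteq> UNIV"
      using assms by (auto simp: finite_dimensional_def)
    then obtain e where "norm e = 1" "\<And>s. s \<in> span (f ` {..<n}) \<Longrightarrow> 1/2 \<le> norm (e - s)"
      using riesz_lemma[of "f ` {..<n}"] by auto
    then show "\<exists>r. norm r = 1 \<and> (\<forall>m<n. 1/2 \<le> norm (r - f m))"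
      by (intro exI[of _ e]) (auto intro: span_base)
  qed auto
  then obtain e :: "nat \<Rightarrow> 'a" where e: "\<And>n. norm (e n) = 1" "\<And>m n. m < n \<Longrightarrow> 1/2 \<le> norm (e n - e m)"
    by blast
  then have "1/2 \<le> norm (e m - e n)" if "m \<noteq> n" for m n
    using that e(2)[of m n] e(2)[of n m] by (cases "m < n") (auto simp: norm_minus_commute)
  with e(1) show ?thesis by (rule that)
qed

subsection \<open>The Mazur--Ulam theorem\<close>

text \<open>This bound is the same for all isometries, and repeated doubling of the defect will
  contradict it unless the defect is zero. It holds because the midpoint and its image are at
  distance \<open>dist p q / 2\<close> from both endpoints and their images.\<close>

lemma isometry_midpoint_defect:
  fixes g :: "'a::real_normed_vector \<Rightarrow> 'b::real_normed_vector"
  assumes "\<And>x y. dist (g x) (g y) = dist x y"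
  shows "2 * dist (g ((p + q) /\<^sub>R 2)) ((g p + g q) /\<^sub>R 2) \<le> dist p q"
proof -
  define m where "m = (p + q) /\<^sub>R 2"
  have mp: "dist m p = dist p q / 2" and mq: "dist m q = dist p q / 2"
  proof -
    have "2 *\<^sub>R (m - p) = q - p" "2 *\<^sub>R (m - q) = p - q"
      by (simp_all add: m_def scaleR_diff_right scaleR_2)
    then have "norm (2 *\<^sub>R (m - p)) = dist p q" "norm (2 *\<^sub>R (m - q)) = dist p q"
      by (simp_all add: dist_norm norm_minus_commute)
    then show "dist m p = dist p q / 2" "dist m q = dist p q / 2"
      by (simp_all add: dist_norm)
  qed
  have "2 * dist (g m) ((g p + g q) /\<^sub>R 2) = norm (2 *\<^sub>R (g m - (g p + g q) /\<^sub>R 2))"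
    by (simp add: dist_norm)
  also have "2 *\<^sub>R (g m - (g p + g q) /\<^sub>R 2) = (g m - g p) + (g m - g q)"
    by (simp add: scaleR_diff_right scaleR_2)
  also have "norm \<dots> \<le> dist (g m) (g p) + dist (g m) (g q)"
    by (simp add: dist_norm norm_triangle_ineq)
  also have "\<dots> = dist p q" by (simp add: assms mp mq)
  finally show ?thesis by (simp add: m_def)
qed

text \<open>Conjugating the point reflection in the midpoint of the images of \<open>p\<close> and \<open>q\<close> by the
  isometry gives an isometry swapping \<open>p\<close> and \<open>q\<close> with twice the midpoint defect.\<close>

lemma isometry_double_defect:
  fixes f :: "'a::real_normed_vector \<Rightarrow> 'b::real_normed_vector"
  assumes f: "bij f" "\<And>x y. dist (f x) (f y) = dist x y"
  obtains g :: "'a \<Rightarrow> 'a" where "bij g" "\<And>x y. dist (g x) (g y) = dist x y"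
    "dist (g ((p + q) /\<^sub>R 2)) ((g p + g q) /\<^sub>R 2) = 2 * dist (f ((p + q) /\<^sub>R 2)) ((f p + f q) /\<^sub>R 2)"
proof -
  define g where "g x = inv f (f p + f q - f x)" for x
  have fg: "f (g x) = f p + f q - f x" for x
    using f(1) by (simp add: g_def bij_is_surj surj_f_inv_f)
  have inj: "x = y" if "f x = f y" for x y
    using f(1) that by (simp add: bij_def inj_eq)
  have dist_g: "dist (g x) (g y) = dist x y" for x y
    using f(2)[of "g x" "g y"] f(2)[of x y] by (simp add: fg dist_norm norm_minus_commute)
  have gg: "g (g x) = x" for x
    by (rule inj) (simp add: fg)
  have "bij g" by (rule bij_betw_byWitness[where f' = g]) (auto simp: gg)
  have "g p = q" "g q = p" by (rule inj; simp add: fg)+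
  then have "(g p + g q) /\<^sub>R 2 = (p + q) /\<^sub>R 2" by (simp add: add.commute)
  then have "dist (g ((p + q) /\<^sub>R 2)) ((g p + g q) /\<^sub>R 2) =
      dist (f (g ((p + q) /\<^sub>R 2))) (f ((p + q) /\<^sub>R 2))"
    by (simp add: f(2))
  also have "\<dots> = norm (2 *\<^sub>R (f ((p + q) /\<^sub>R 2) - (f p + f q) /\<^sub>R 2))"
    by (simp add: fg dist_norm scaleR_diff_right scaleR_2 norm_minus_commute diff_diff_eq)
  also have "\<dots> = 2 * dist (f ((p + q) /\<^sub>R 2)) ((f p + f q) /\<^sub>R 2)"
    by (simp add: dist_norm)
  finally show ?thesis using \<open>bij g\<close> dist_g that by blast
qed

text \<open>Each doubling yields another bijective isometry of the same space with the same
  \<open>p\<close> and \<open>q\<close>, so it can be iterated; the uniform bound applies to the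
  last one.\<close>

lemma isometry_self_midpoint_defect:
  fixes g :: "'a::real_normed_vector \<Rightarrow> 'a"
  assumes "bij g" "\<And>x y. dist (g x) (g y) = dist x y"
  shows "2 ^ n * dist (g ((p + q) /\<^sub>R 2)) ((g p + g q) /\<^sub>R 2) \<le> dist p q"
  using assms
proof (induction n arbitrary: g)
  case 0
  then have "2 * dist (g ((p + q) /\<^sub>R 2)) ((g p + g q) /\<^sub>R 2) \<le> dist p q"
    by (intro isometry_midpoint_defect)
  moreover have "0 \<le> dist (g ((p + q) /\<^sub>R 2)) ((g p + g q) /\<^sub>R 2)"
    by (rule zero_le_dist)
  ultimately show ?case unfolding power_0 mult_1 by linarith
next
  case (Suc n)
  obtain h :: "'a \<Rightarrow> 'a" where "bij h" "\<And>x y. dist (h x) (h y) = dist x y"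
    "dist (h ((p + q) /\<^sub>R 2)) ((h p + h q) /\<^sub>R 2) = 2 * dist (g ((p + q) /\<^sub>R 2)) ((g p + g q) /\<^sub>R 2)"
    using isometry_double_defect[OF Suc.prems] by blast
  then show ?case using Suc.IH[of h] by simp
qed

text \<open>One doubling replaces the map between two spaces by a self-map of the first, whose
  defect is at most \<open>dist p q / 2 ^ n\<close> for every \<open>n\<close>.\<close>

theorem isometry_midpoint:
  fixes f :: "'a::real_normed_vector \<Rightarrow> 'b::real_normed_vector"
  assumes "bij f" "\<And>x y. dist (f x) (f y) = dist x y"
  shows "f ((p + q) /\<^sub>R 2) = (f p + f q) /\<^sub>R 2"
proof -
  obtain g :: "'a \<Rightarrow> 'a" where g: "bij g" "\<And>x y. dist (g x) (g y) = dist x y"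
    "dist (g ((p + q) /\<^sub>R 2)) ((g p + g q) /\<^sub>R 2) = 2 * dist (f ((p + q) /\<^sub>R 2)) ((f p + f q) /\<^sub>R 2)"
    using isometry_double_defect[OF assms] by blast
  define d where "d = dist (g ((p + q) /\<^sub>R 2)) ((g p + g q) /\<^sub>R 2)"
  have "d = 0"
  proof (rule ccontr)
    assume "d \<noteq> 0"
    then have "d > 0" by (simp add: d_def)
    then obtain n where "dist p q / d < 2 ^ n"
      using real_arch_pow[of 2] by auto
    then have "dist p q < 2 ^ n * d" using \<open>d > 0\<close> by (simp add: field_simps)
    then show False
      using isometry_self_midpoint_defect[OF g(1,2), of n p q] by (simp add: d_def)
  qed
  then show ?thesis using g(3) by (simp add: d_def)
qed

theorem mazur_ulam:
  fixes f :: "'a::real_normed_vector \<Rightarrow> 'b::real_normed_vector"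
  assumes "bij f" "\<And>x y. dist (f x) (f y) = dist x y" "f 0 = 0"
  shows "linear f"
proof -
  have half: "f (x /\<^sub>R 2) = f x /\<^sub>R 2" for x
    using isometry_midpoint[OF assms(1,2), of x 0] assms(3) by simp
  have add: "f (x + y) = f x + f y" for x y
    using isometry_midpoint[OF assms(1,2), of x y] half[of "x + y"] by simp
  have neg: "f (- x) = - f x" for x
    using add[of x "- x"] assms(3) minus_unique[of "f x" "f (- x)"] by simp
  have nat: "f (real n *\<^sub>R x) = real n *\<^sub>R f x" for n x
    by (induction n) (simp_all add: assms(3) add scaleR_add_left)
  have int: "f (of_int k *\<^sub>R x) = of_int k *\<^sub>R f x" for k x
    by (cases k rule: int_cases2) (simp_all add: nat neg)
  have rat: "f (q *\<^sub>R x) = q *\<^sub>R f x" if "q \<in> \<rat>" for q x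
  proof -
    obtain a b where ab: "b > 0" "q = of_int a / of_int b"
      using \<open>q \<in> \<rat>\<close> by (meson Rats_cases')
    then have "of_int b *\<^sub>R f (q *\<^sub>R x) = of_int a *\<^sub>R f x"
      using int[of b "q *\<^sub>R x"] int[of a x] by simp
    then have "(1 / of_int b) *\<^sub>R of_int b *\<^sub>R f (q *\<^sub>R x) = (1 / of_int b) *\<^sub>R of_int a *\<^sub>R f x"
      by simp
    then show ?thesis using ab by simp
  qed
  have cont: "continuous_on UNIV f"
    unfolding continuous_on_iff using assms(2) by auto
  have "f (c *\<^sub>R x) = c *\<^sub>R f x" for c x
  proof -
    have "continuous_on (closure \<rat>) (\<lambda>c. f (c *\<^sub>R x) - c *\<^sub>R f x)"
      by (intro continuous_intros continuous_on_compose2[OF cont]) auto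
    then have "f (c *\<^sub>R x) - c *\<^sub>R f x = 0"
      by (rule continuous_constant_on_closure) (auto simp: rat Rats_closure_real)
    then show ?thesis by simp
  qed
  with add show ?thesis by (intro linearI) auto
qed

subsection \<open>The spaces of smooth Lipschitz functions\<close>

text \<open>The constant \<open>C\<close> is the same for all centres and radii. This scale
  invariance bounds the peak sets in terms of \<open>r\<close>, and later makes bumps of height
  proportional to their radius uniformly Lipschitz.\<close>

definition has_bumps :: "('a::real_normed_vector \<Rightarrow> real) set \<Rightarrow> real \<Rightarrow> bool"
  where "has_bumps A C \<longleftrightarrow> (\<forall>x. \<forall>r>0. \<exists>f\<in>A. (\<forall>z. 0 \<le> f z \<and> f z \<le> 1) \<and> f x = 1 \<and>
    (\<forall>z. r \<le> dist z x \<longrightarrow> f z = 0) \<and> (C/r)-lipschitz_on UNIV f)"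

lemma has_bumpsE:
  assumes "has_bumps A C" "0 < r"
  obtains f where "f \<in> A" "\<And>z. 0 \<le> f z" "\<And>z. f z \<le> 1" "f x = 1"
    "\<And>z. r \<le> dist z x \<Longrightarrow> f z = 0" "(C/r)-lipschitz_on UNIV f"
  using assms unfolding has_bumps_def by blast

lemma lipschitz_on_compose_affine:
  fixes f :: "'a::real_normed_vector \<Rightarrow> real" and \<phi> :: "real \<Rightarrow> real"
  assumes "M-lipschitz_on UNIV \<phi>" "L-lipschitz_on UNIV f"
  shows "(M * L * \<bar>k\<bar>)-lipschitz_on UNIV (\<lambda>z. \<phi> (f (a + k *\<^sub>R z)))"
proof (rule lipschitz_onI)
  have nn: "0 \<le> M" "0 \<le> L" using assms lipschitz_on_nonneg by auto
  then show "0 \<le> M * L * \<bar>k\<bar>" by simp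
  fix x y
  have "dist (\<phi> (f (a + k *\<^sub>R x))) (\<phi> (f (a + k *\<^sub>R y))) \<le> M * dist (f (a + k *\<^sub>R x)) (f (a + k *\<^sub>R y))"
    by (rule lipschitz_onD[OF assms(1)]) auto
  also have "\<dots> \<le> M * (L * dist (a + k *\<^sub>R x) (a + k *\<^sub>R y))"
    by (intro mult_left_mono lipschitz_onD[OF assms(2)] nn) auto
  also have "dist (a + k *\<^sub>R x) (a + k *\<^sub>R y) = \<bar>k\<bar> * dist x y"
    by (simp add: dist_norm flip: scaleR_diff_right)
  finally show "dist (\<phi> (f (a + k *\<^sub>R x))) (\<phi> (f (a + k *\<^sub>R y))) \<le> M * L * \<bar>k\<bar> * dist x y"
    by (simp add: mult.assoc)
qed

lemma CbG_compose_affine: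
  fixes f :: "'a::real_normed_vector \<Rightarrow> real"
  assumes "f \<in> CbG" "bounded (range \<phi>)" "M-lipschitz_on UNIV \<phi>"
    and "\<And>s. (\<phi> has_real_derivative \<phi>' s) (at s)"
  shows "(\<lambda>z. \<phi> (f (a + k *\<^sub>R z))) \<in> CbG"
proof -
  have "bounded (range (\<lambda>z. \<phi> (f (a + k *\<^sub>R z))))"
    by (rule bounded_subset[OF assms(2)]) auto
  then show ?thesis
    using assms lipschitz_on_compose_affine[OF assms(3)] gateaux_differentiable_compose_affine
    unfolding CbG_def by blast
qed

lemma CbF_compose_affine:
  fixes f :: "'a::real_normed_vector \<Rightarrow> real"
  assumes "f \<in> CbF" "bounded (range \<phi>)" "M-lipschitz_on UNIV \<phi>"
    and "\<And>s. (\<phi> has_real_derivative \<phi>' s) (at s)"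
  shows "(\<lambda>z. \<phi> (f (a + k *\<^sub>R z))) \<in> CbF"
proof -
  have "bounded (range (\<lambda>z. \<phi> (f (a + k *\<^sub>R z))))"
    by (rule bounded_subset[OF assms(2)]) auto
  moreover have "(\<lambda>z. \<phi> (f (a + k *\<^sub>R z))) differentiable (at x)" for x
  proof -
    have "\<phi> differentiable (at s)" for s
      using assms(4)[of s] by (auto simp: differentiable_def has_field_derivative_def)
    moreover have "f differentiable (at y)" for y
      using assms(1) by (simp add: CbF_def)
    ultimately show ?thesis
      using differentiable_chain_at[OF _ differentiable_chain_at, of "\<lambda>z. a + k *\<^sub>R z" x f \<phi>]
      by (simp add: o_def)
  qed
  ultimately show ?thesis
    using assms(1) lipschitz_on_compose_affine[OF assms(3)] unfolding CbF_def by blast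
qed

text \<open>One bump is moved and rescaled by affine maps after its values have been normalised. The
  hypothesis \<open>compose\<close> is what both smoothness classes provide.\<close>

lemma has_bumps_if_bump_function:
  assumes b: "bump_function b" "L-lipschitz_on UNIV b"
    and compose: "\<And>\<phi> M \<phi>' a k. bounded (range \<phi>) \<Longrightarrow> M-lipschitz_on UNIV \<phi> \<Longrightarrow>
      (\<And>s::real. (\<phi> has_real_derivative \<phi>' s) (at s)) \<Longrightarrow> (\<lambda>z. \<phi> (b (a + k *\<^sub>R z))) \<in> A"
  shows "\<exists>C. has_bumps A C"
proof -
  obtain x0 where "b x0 \<noteq> 0" "0 \<le> b x0" using b(1) by (auto simp: bump_function_def)
  then have x0: "0 < b x0" by simp
  have "bounded {x. b x \<noteq> 0}"
    using b(1) bounded_subset closure_subset unfolding bump_function_def by blast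
  then obtain R where R: "0 < R" "\<And>x. b x \<noteq> 0 \<Longrightarrow> norm x < R"
    unfolding bounded_pos by (metis (mono_tags) less_add_one mem_Collect_eq order_le_less_trans add_pos_pos zero_less_one)
  \<comment> \<open>Since \<open>b\<close> may exceed \<open>b x0\<close> elsewhere, dividing by
    \<open>b x0\<close> would not keep the values below 1. The cosine profile does: it is 0 at 0, 1
    at \<open>b x0\<close>, and stays in the unit interval everywhere.\<close>
  define w where "w = pi / b x0"
  define \<phi> where "\<phi> s = (1 - cos (w * s)) / 2" for s
  have w: "0 < w" using x0 by (simp add: w_def)
  have der: "(\<phi> has_real_derivative w * sin (w * s) / 2) (at s)" for s
    unfolding \<phi>_def by (auto intro!: derivative_eq_intros)
  have range: "0 \<le> \<phi> s" "\<phi> s \<le> 1" for s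
    using cos_ge_minus_one[of "w * s"] by (auto simp: \<phi>_def)
  then have bdd: "bounded (range \<phi>)"
    by (auto simp: bounded_iff intro!: exI[of _ 1])
  have lip: "w-lipschitz_on UNIV \<phi>"
  proof (rule lipschitz_onI)
    have "\<bar>sin (w * s)\<bar> \<le> 2" for s
      using abs_sin_le_one[of "w * s"] by linarith
    then have "\<bar>w * sin (w * s) / 2\<bar> \<le> w" for s
      using w by (simp add: abs_mult)
    then show "dist (\<phi> s) (\<phi> t) \<le> w * dist s t" for s t
      using field_differentiable_bound[OF convex_UNIV, of \<phi> "\<lambda>s. w * sin (w * s) / 2" w s t] der
      by (simp add: dist_norm)
  qed (use w in simp)
  define C where "C = w * L * (R + norm x0)"
  have "has_bumps A C"
    unfolding has_bumps_def
  proof (intro allI impI)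
    fix x and r :: real assume r: "0 < r"
    \<comment> \<open>The affine map sends \<open>x\<close> to \<open>x0\<close>, and points at
      distance at least \<open>r\<close> from \<open>x\<close> to points of norm at least
      \<open>R\<close>, where \<open>b\<close> vanishes.\<close>
    define k where "k = (R + norm x0) / r"
    have k: "0 < k" using r R(1) by (simp add: k_def add_pos_nonneg)
    define f where "f z = \<phi> (b ((x0 - k *\<^sub>R x) + k *\<^sub>R z))" for z
    have "f z = 0" if z: "r \<le> dist z x" for z
    proof -
      have "R + norm x0 \<le> norm (k *\<^sub>R (z - x))"
      proof -
        have "R + norm x0 = k * r" using r by (simp add: k_def)
        also have "\<dots> \<le> k * norm (z - x)" using z k by (simp add: dist_norm)
        also have "\<dots> = norm (k *\<^sub>R (z - x))" using k by simp
        finally show ?thesis .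
      qed
      also have "\<dots> \<le> norm (x0 + k *\<^sub>R (z - x)) + norm x0"
        using norm_triangle_ineq4[of "x0 + k *\<^sub>R (z - x)" x0] by simp
      finally have "b (x0 + k *\<^sub>R (z - x)) = 0"
        using R(2) by fastforce
      then show ?thesis by (simp add: f_def \<phi>_def algebra_simps)
    qed
    moreover have "f x = 1" using x0 by (simp add: f_def \<phi>_def w_def)
    moreover have "w * L * \<bar>k\<bar> = C/r"
      unfolding abs_of_pos[OF k] by (simp add: C_def k_def)
    then have "(C/r)-lipschitz_on UNIV f"
      using lipschitz_on_compose_affine[OF lip b(2), of k "x0 - k *\<^sub>R x"]
      by (simp add: f_def[abs_def])
    moreover have "f \<in> A"
      unfolding f_def by (rule compose[OF bdd lip der])
    ultimately show "\<exists>f\<in>A. (\<forall>z. 0 \<le> f z \<and> f z \<le> 1) \<and> f x = 1 \<and>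
        (\<forall>z. r \<le> dist z x \<longrightarrow> f z = 0) \<and> (C/r)-lipschitz_on UNIV f"
      using range by (intro bexI[of _ f]) (auto simp: f_def)
  qed
  then show ?thesis by blast
qed

lemma CbG_has_bumps:
  fixes b :: "'a::real_normed_vector \<Rightarrow> real"
  assumes "b \<in> CbG" "bump_function b"
  shows "\<exists>C. has_bumps (CbG :: ('a \<Rightarrow> real) set) C"
proof -
  obtain L where "L-lipschitz_on UNIV b" using assms(1) by (auto simp: CbG_def)
  from assms(2) this show ?thesis
    by (rule has_bumps_if_bump_function) (blast intro: CbG_compose_affine[OF assms(1)])
qed

lemma CbF_has_bumps:
  fixes b :: "'a::real_normed_vector \<Rightarrow> real"
  assumes "b \<in> CbF" "bump_function b"
  shows "\<exists>C. has_bumps (CbF :: ('a \<Rightarrow> real) set) C"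
proof -
  obtain L where "L-lipschitz_on UNIV b" using assms(1) by (auto simp: CbF_def)
  from assms(2) this show ?thesis
    by (rule has_bumps_if_bump_function) (blast intro: CbF_compose_affine[OF assms(1)])
qed

text \<open>A nonzero functional is unbounded and so not in \<open>CbF\<close>. These functions are
  bounded by \<open>k\<close>, keep Lipschitz constant 1, and approach \<open>l y - a\<close> as
  \<open>k\<close> grows.\<close>

lemma sin_functional_CbF:
  fixes l :: "'a::real_normed_vector \<Rightarrow> real"
  assumes l: "linear l" "\<And>y. \<bar>l y\<bar> \<le> norm y" and k: "0 < k"
  shows "(\<lambda>y. k * sin ((l y - a) / k)) \<in> CbF" and "1-lipschitz_on UNIV (\<lambda>y. k * sin ((l y - a) / k))"
proof -
  define g where "g y = k * sin ((l y - a) / k)" for y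
  have "bounded_linear l"
    using l(2) by (intro bounded_linear_intro[of l 1]) (auto simp: linear_add linear_cmul l(1))
  then have "(g has_derivative (\<lambda>h. cos ((l x - a) / k) * l h)) (at x)" for x
    unfolding g_def using k bounded_linear_imp_has_derivative[of l]
    by (auto intro!: derivative_eq_intros simp: field_simps)
  then have diff: "g differentiable (at x)" for x
    by (auto simp: differentiable_def)
  have "\<bar>g y\<bar> \<le> k" for y
    using k mult_left_le[of "\<bar>sin ((l y - a) / k)\<bar>" k] by (simp add: g_def abs_mult)
  then have bdd: "bounded (range g)" by (auto simp: bounded_iff)
  have "dist (g y) (g z) \<le> 1 * dist y z" for y z
  proof -
    have sin: "\<bar>sin s - sin t\<bar> \<le> 1 * \<bar>s - t\<bar>" for s t :: real
      using field_differentiable_bound[OF convex_UNIV, of sin cos 1 s t]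
      by (auto intro!: derivative_eq_intros)
    have "\<bar>g y - g z\<bar> = k * \<bar>sin ((l y - a) / k) - sin ((l z - a) / k)\<bar>"
      using k by (simp add: g_def abs_mult flip: right_diff_distrib)
    also have "\<dots> \<le> k * (1 * \<bar>(l y - a) / k - (l z - a) / k\<bar>)"
      using k by (intro mult_left_mono sin) simp
    also have "\<dots> = \<bar>l (y - z)\<bar>"
      using k by (simp add: linear_diff[OF l(1)] flip: diff_divide_distrib)
    also have "\<dots> \<le> norm (y - z)" by (rule l(2))
    finally show ?thesis by (simp add: dist_norm)
  qed
  then have "1-lipschitz_on UNIV g" by (intro lipschitz_onI) auto
  with diff bdd show "(\<lambda>y. k * sin ((l y - a) / k)) \<in> CbF" "1-lipschitz_on UNIV (\<lambda>y. k * sin ((l y - a) / k))"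
    by (auto simp: CbF_def g_def[abs_def])
qed

section \<open>Linear combinations and finite sums\<close>

lemma has_gateaux_derivative_linear_combination:
  fixes f g :: "'a::real_normed_vector \<Rightarrow> real"
  assumes "has_gateaux_derivative f D x" "has_gateaux_derivative g E x"
  shows "has_gateaux_derivative (\<lambda>x. a * f x + b * g x) (\<lambda>h. a * D h + b * E h) x"
  using assms
  by (auto simp: has_gateaux_derivative_iff_DERIV intro!: derivative_eq_intros bounded_linear_add bounded_linear_const_mult)

lemma CbG_linear_combination:
  fixes f g :: "'a::real_normed_vector \<Rightarrow> real"
  assumes f: "f \<in> CbG" and g: "g \<in> CbG"
  shows "(\<lambda>x. a * f x + b * g x) \<in> CbG"
proof -
  obtain M N where "\<And>x. \<bar>f x\<bar> \<le> M" "\<And>x. \<bar>g x\<bar> \<le> N"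
    using f g by (auto simp: CbG_def bounded_iff)
  then have "\<bar>a * f x + b * g x\<bar> \<le> \<bar>a\<bar> * M + \<bar>b\<bar> * N" for x
    by (intro order_trans[OF abs_triangle_ineq] add_mono) (auto simp: abs_mult intro: mult_left_mono)
  then have "bounded (range (\<lambda>x. a * f x + b * g x))"
    by (auto simp: bounded_iff)
  moreover obtain K L where "K-lipschitz_on UNIV f" "L-lipschitz_on UNIV g"
    using f g by (auto simp: CbG_def)
  then have "(\<bar>a\<bar> * K + \<bar>b\<bar> * L)-lipschitz_on UNIV (\<lambda>x. a * f x + b * g x)"
    by (intro lipschitz_on_add lipschitz_on_cmult_real)
  moreover have "gateaux_differentiable (\<lambda>x. a * f x + b * g x) x" for x
    using f g has_gateaux_derivative_linear_combination unfolding CbG_def gateaux_differentiable_def by blast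
  ultimately show ?thesis unfolding CbG_def by blast
qed

lemma has_gateaux_derivative_sum:
  fixes f :: "'i \<Rightarrow> 'a::real_normed_vector \<Rightarrow> real"
  assumes "\<And>i. i \<in> I \<Longrightarrow> has_gateaux_derivative (f i) (D i) x"
  shows "has_gateaux_derivative (\<lambda>x. \<Sum>i\<in>I. f i x) (\<lambda>h. \<Sum>i\<in>I. D i h) x"
  using assms
  by (auto simp: has_gateaux_derivative_iff_DERIV intro!: DERIV_sum bounded_linear_sum)

text \<open>The difference quotients converge uniformly over a finite net of directions, and the
  Lipschitz bounds of \<open>f\<close> and \<open>D\<close> carry the estimate from the net to every
  direction in the unit ball.\<close>

lemma lipschitz_has_gateaux_derivative_imp_has_derivative:
  fixes f :: "'a::real_normed_vector \<Rightarrow> real"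
  assumes cpt: "compact (cball (0::'a) 1)" and L: "L-lipschitz_on UNIV f"
    and D: "has_gateaux_derivative f D x"
  shows "(f has_derivative D) (at x)"
proof -
  interpret bounded_linear D using D by (simp add: has_gateaux_derivative_def)
  obtain K where K: "0 < K" "\<And>h. \<bar>D h\<bar> \<le> norm h * K"
    using pos_bounded by auto
  have L0: "0 \<le> L" using L by (rule lipschitz_on_nonneg)
  have "\<exists>d>0. \<forall>y. norm (y - x) < d \<longrightarrow> norm (f y - f x - D (y - x)) \<le> e * norm (y - x)" if e: "0 < e" for e
  proof -
    define c where "c = L + K"
    \<comment> \<open>Replacing a direction by a net point within \<open>\<eta>\<close> costs at
      most \<open>L * \<eta>\<close> for \<open>f\<close> and \<open>K * \<eta>\<close> for
      \<open>D\<close> per unit length, half of \<open>e\<close> together; the quotients on the net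
      take the other half.\<close>
    define \<eta> where "\<eta> = e / (2 * c)"
    have "0 < c" using K(1) L0 by (simp add: c_def)
    then have "0 < \<eta>" "c * \<eta> = e / 2"
      using e by (simp_all add: \<eta>_def)
    then have \<eta>: "0 < \<eta>" "(L + K) * \<eta> = e / 2"
      by (simp_all add: c_def)
    obtain N where N: "finite N" "cball (0::'a) 1 \<subseteq> (\<Union>h\<in>N. ball h \<eta>)"
      using compactE_image[OF cpt, of "cball 0 1" "\<lambda>h. ball h \<eta>"] \<eta>(1) by (metis centre_in_ball open_ball UN_I subsetI)
    have "\<forall>\<^sub>F t in at 0. \<bar>(f (x + t *\<^sub>R h) - f x) / t - D h\<bar> < e / 2" for h
      using D tendstoD[of "\<lambda>t. (f (x + t *\<^sub>R h) - f x) / t" "D h" "at 0" "e/2"] e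
      by (simp add: has_gateaux_derivative_iff_DERIV DERIV_def dist_real_def)
    then have "\<forall>\<^sub>F t in at 0. \<forall>h\<in>N. \<bar>(f (x + t *\<^sub>R h) - f x) / t - D h\<bar> < e / 2"
      by (intro eventually_ball_finite N) auto
    then obtain d where d: "0 < d"
      "\<And>t h. t \<noteq> 0 \<Longrightarrow> \<bar>t\<bar> < d \<Longrightarrow> h \<in> N \<Longrightarrow> \<bar>(f (x + t *\<^sub>R h) - f x) / t - D h\<bar> < e / 2"
      by (auto simp: eventually_at)
    have "norm (f y - f x - D (y - x)) \<le> e * norm (y - x)" if y: "norm (y - x) < d" for y
    proof (cases "y = x")
      case False
      define t where "t = norm (y - x)"
      define u where "u = (y - x) /\<^sub>R t"
      have t: "0 < t" "t < d" using False y by (auto simp: t_def)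
      have yx: "y - x = t *\<^sub>R u" using t by (simp add: u_def)
      have "u \<in> cball 0 1" using t by (simp add: u_def t_def)
      then obtain h where h: "h \<in> N" "norm (h - u) < \<eta>"
        using N(2) by (auto simp: dist_norm)
      have "\<bar>(f (x + t *\<^sub>R h) - f x) / t - D h\<bar> < e / 2"
        using d(2)[OF _ _ h(1), of t] t by simp
      moreover have "(f (x + t *\<^sub>R h) - f x) / t - D h = (f (x + t *\<^sub>R h) - f x - t * D h) / t"
        using t by (simp add: field_simps)
      ultimately have 1: "\<bar>f (x + t *\<^sub>R h) - f x - t * D h\<bar> \<le> e / 2 * t"
        using t by (simp add: pos_divide_less_eq)
      have "\<bar>f y - f (x + t *\<^sub>R h)\<bar> \<le> L * norm (y - (x + t *\<^sub>R h))"
        using lipschitz_onD[OF L, of y "x + t *\<^sub>R h"] by (simp add: dist_norm)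
      also have "y - (x + t *\<^sub>R h) = t *\<^sub>R (u - h)"
        using yx by (simp add: algebra_simps)
      also have "L * norm (t *\<^sub>R (u - h)) \<le> L * (t * \<eta>)"
        using t h(2) L0 by (intro mult_left_mono) (auto simp: norm_minus_commute)
      finally have 2: "\<bar>f y - f (x + t *\<^sub>R h)\<bar> \<le> L * (t * \<eta>)" .
      have "\<bar>t * D h - D (y - x)\<bar> = t * \<bar>D (h - u)\<bar>"
        using t yx by (simp add: scaleR diff abs_mult flip: right_diff_distrib)
      also have "\<dots> \<le> t * (\<eta> * K)"
        using t h(2) K by (intro mult_left_mono order_trans[OF K(2)] mult_right_mono) auto
      finally have "\<bar>f y - f x - D (y - x)\<bar> \<le> L * (t * \<eta>) + e / 2 * t + t * (\<eta> * K)"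
        using 1 2 by linarith
      also have "\<dots> = ((L + K) * \<eta> + e / 2) * t" by (simp add: algebra_simps)
      also have "\<dots> = e * t" by (simp add: \<eta>(2))
      finally show ?thesis by (simp add: t_def)
    qed simp
    then show ?thesis using d(1) by blast
  qed
  then show ?thesis by (auto simp: has_derivative_at_alt bounded_linear_axioms)
qed

lemma CbG_eq_CbF_if_compact_cball:
  assumes "compact (cball (0::'a::real_normed_vector) 1)"
  shows "(CbG :: ('a \<Rightarrow> real) set) = CbF"
proof (rule antisym[OF _ CbF_subset_CbG])
  show "(CbG :: ('a \<Rightarrow> real) set) \<subseteq> CbF"
    using lipschitz_has_gateaux_derivative_imp_has_derivative[OF assms]
    unfolding CbG_def CbF_def gateaux_differentiable_def differentiable_def by blast
qed

subsection \<open>A Banach--Stone theorem\<close>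

text \<open>The graph of a norm preserving unital linear bijection between two function spaces,
  kept as a relation so that the situation is symmetric.\<close>

locale isometric_correspondence =
  fixes R :: "('a::banach \<Rightarrow> real) \<Rightarrow> ('b::banach \<Rightarrow> real) \<Rightarrow> bool"
    and A :: "('a \<Rightarrow> real) set" and B :: "('b \<Rightarrow> real) set" and C C' :: real
  assumes total: "\<And>f. f \<in> A \<Longrightarrow> \<exists>g. R f g"
    and surj: "\<And>g. g \<in> B \<Longrightarrow> \<exists>f. R f g"
    and dom: "\<And>f g. R f g \<Longrightarrow> f \<in> A"
    and ran: "\<And>f g. R f g \<Longrightarrow> g \<in> B"
    and bounded_dom: "\<And>f. f \<in> A \<Longrightarrow> bounded (range f)"
    and lipschitz_ran: "\<And>g. g \<in> B \<Longrightarrow> \<exists>L. L-lipschitz_on UNIV g"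
    and bounded_ran: "\<And>g. g \<in> B \<Longrightarrow> bounded (range g)"
    and lipschitz_dom: "\<And>f. f \<in> A \<Longrightarrow> \<exists>L. L-lipschitz_on UNIV f"
    and bumps_dom: "has_bumps A C"
    and bumps_ran: "has_bumps B C'"
    and one: "R (\<lambda>_. 1) (\<lambda>_. 1)"
    and combine: "\<And>f g f' g' a b. R f g \<Longrightarrow> R f' g' \<Longrightarrow>
      R (\<lambda>x. a * f x + b * f' x) (\<lambda>y. a * g y + b * g' y)"
    and bound_iff: "\<And>f g M. R f g \<Longrightarrow> (\<forall>x. \<bar>f x\<bar> \<le> M) \<longleftrightarrow> (\<forall>y. \<bar>g y\<bar> \<le> M)"
    and lipschitz_iff: "\<And>f g K. R f g \<Longrightarrow> K-lipschitz_on UNIV f \<longleftrightarrow> K-lipschitz_on UNIV g"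
begin

lemma swap: "isometric_correspondence (\<lambda>g f. R f g) B A C' C"
  by unfold_locales
    (fact surj total ran dom bounded_ran lipschitz_dom bounded_dom lipschitz_ran bumps_ran bumps_dom
      one combine bound_iff[symmetric] lipschitz_iff[symmetric])+

lemma almost_attained:
  assumes "R f g" "c < f x"
  obtains y where "c < \<bar>g y\<bar>"
  using bound_iff[OF assms(1), of c] assms(2) by (metis abs_ge_self leD leI order_trans)

text \<open>Order is recovered from the sup norm and the constant one: a function lies between 0 and
  1 exactly when twice it minus one is bounded by 1.\<close>

lemma unit_interval:
  assumes "R f g" "\<And>x. 0 \<le> f x" "\<And>x. f x \<le> 1"
  shows "0 \<le> g y" "g y \<le> 1"
proof -
  have "R (\<lambda>x. 2 * f x + (-1) * 1) (\<lambda>y. 2 * g y + (-1) * 1)"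
    by (rule combine[OF assms(1) one])
  moreover have "\<forall>x. \<bar>2 * f x + (-1) * 1\<bar> \<le> 1"
    using assms(2,3) by (smt (verit))
  ultimately have "\<bar>2 * g y + (-1) * 1\<bar> \<le> 1"
    using bound_iff by blast
  then show "0 \<le> g y" "g y \<le> 1" by (auto simp: abs_le_iff)
qed

text \<open>The image of a function concentrated near \<open>x\<close> is concentrated in a small set: disjoint bumps
  at two distant points where the image is large would pull back to Lipschitz functions that are
  both large near \<open>x\<close>, although the sum of the bumps has norm at most one.\<close>

lemma peak_set_diameter:
  assumes Rf: "R f g" and f: "\<And>z. 0 \<le> f z" "\<And>z. f z \<le> 1" "\<And>z. r \<le> dist z x \<Longrightarrow> f z = 0"
    and r: "0 < r" and y: "3/4 < g y" "3/4 < g y'"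
  shows "dist y y' \<le> 8 * C' * r"
proof (cases "y = y'")
  case True
  have "0 \<le> C'/1"
    by (rule has_bumpsE[OF bumps_ran zero_less_one, of y]) (rule lipschitz_on_nonneg)
  with True r show ?thesis by simp
next
  case False
  define d where "d = dist y y'"
  have d: "0 < d" "0 < d/2" using False by (simp_all add: d_def)
  obtain b where b: "b \<in> B" "\<And>z. 0 \<le> b z" "\<And>z. b z \<le> 1" "b y = 1" "\<And>z. d/2 \<le> dist z y \<Longrightarrow> b z = 0"
    using has_bumpsE[OF bumps_ran d(2), of y] by metis
  obtain b' where b': "b' \<in> B" "\<And>z. 0 \<le> b' z" "\<And>z. b' z \<le> 1" "b' y' = 1"
      "\<And>z. d/2 \<le> dist z y' \<Longrightarrow> b' z = 0" and L: "(C'/(d/2))-lipschitz_on UNIV b'"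
    using has_bumpsE[OF bumps_ran d(2), of y'] by metis
  obtain u u' where u: "R u b" "R u' b'" using surj b(1) b'(1) by blast
  have "b z + b' z \<le> 1" for z
  proof (cases "d/2 \<le> dist z y")
    case False
    then have "d/2 \<le> dist z y'"
      using dist_triangle2[of y y' z] by (simp add: d_def dist_commute)
    then show ?thesis using b(3)[of z] b'(5)[of z] by simp
  qed (use b(5)[of z] b'(3)[of z] in simp)
  then have "\<forall>z. \<bar>1 * b z + 1 * b' z\<bar> \<le> 1"
    using b(2) b'(2) by (simp add: abs_le_iff)
  then have uu: "u z + u' z \<le> 1" for z
    using bound_iff[OF combine[OF u, of 1 1], of 1] by (auto simp: abs_le_iff)
  \<comment> \<open>At \<open>w\<close> the sum \<open>g + c\<close> exceeds \<open>7/4\<close>, so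
    \<open>f + v\<close> does so in absolute value at some \<open>z\<close>. Both summands are at
    most 1, so both exceed \<open>3/4\<close> there, and \<open>f z > 0\<close> puts
    \<open>z\<close> near \<open>x\<close>.\<close>
  have peak: "\<exists>z. dist z x < r \<and> 3/4 < v z" if v: "R v c" "\<And>z. 0 \<le> c z" "\<And>z. c z \<le> 1" "c w = 1" "3/4 < g w" for v c w
  proof -
    interpret swapped: isometric_correspondence "\<lambda>g f. R f g" B A C' C by (rule swap)
    obtain z where "7/4 < \<bar>1 * f z + 1 * v z\<bar>"
      using swapped.almost_attained[OF combine[OF Rf v(1), of 1 1], of "7/4" w] v(4,5) by auto
    moreover have "0 \<le> v z" "v z \<le> 1"
      using swapped.unit_interval[OF v(1-3)] by auto
    ultimately have "3/4 < v z" "0 < f z"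
      using f(1,2)[of z] by auto
    then show ?thesis using f(3)[of z] by (metis less_irrefl not_le)
  qed
  obtain z where z: "dist z x < r" "3/4 < u z"
    using peak[OF u(1) b(2-4) y(1)] by blast
  obtain z' where z': "dist z' x < r" "3/4 < u' z'"
    using peak[OF u(2) b'(2-4) y(2)] by blast
  have L: "(C'/(d/2))-lipschitz_on UNIV u'"
    using L u(2) lipschitz_iff by blast
  \<comment> \<open>From \<open>u z > 3/4\<close> and \<open>u z + u' z \<le> 1\<close> follows
    \<open>u' z < 1/4\<close>, whereas \<open>u' z' > 3/4\<close>; but \<open>z\<close> and
    \<open>z'\<close> are less than \<open>2 * r\<close> apart.\<close>
  have "1/2 \<le> dist (u' z') (u' z)"
    using uu[of z] z z' by (simp add: dist_real_def)
  also have "\<dots> \<le> C'/(d/2) * dist z' z"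
    by (rule lipschitz_onD[OF L]) auto
  also have "\<dots> \<le> C'/(d/2) * (2 * r)"
    using z(1) z'(1) dist_triangle2[of z' z x] lipschitz_on_nonneg[OF L]
    by (intro mult_left_mono) auto
  also have "\<dots> = 4 * C' * r / d" by simp
  finally have "1/2 * d \<le> 4 * C' * r"
    using d by (simp only: pos_le_divide_eq)
  then show ?thesis by (simp add: d_def)
qed

text \<open>The peak sets of the images \<open>q n\<close> need not be nested, but any two of them
  meet and their diameters tend to zero, so points chosen in them form a Cauchy sequence. An
  arbitrary \<open>g\<close> is evaluated at its limit by adding a large multiple of a bump to
  \<open>f\<close>, which drives near-maximal points of the image into the peak sets.\<close>

lemma ex_image_point: "\<exists>y. \<forall>f g. R f g \<longrightarrow> f x \<le> g y"
proof -
  define r where "r n = 1 / real (Suc n)" for n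
  have r: "0 < r n" for n by (simp add: r_def)
  have r0: "r \<longlonglongrightarrow> 0"
    unfolding r_def using LIMSEQ_inverse_real_of_nat by (simp add: inverse_eq_divide)
  have "\<exists>f g. R f g \<and> (\<forall>z. 0 \<le> f z) \<and> (\<forall>z. f z \<le> 1) \<and> f x = 1 \<and> (\<forall>z. r n \<le> dist z x \<longrightarrow> f z = 0)" for n
    using has_bumpsE[OF bumps_dom r[of n], of x] total by metis
  then obtain p q where pq: "\<And>n. R (p n) (q n)" "\<And>n z. 0 \<le> p n z" "\<And>n z. p n z \<le> 1" "\<And>n. p n x = 1"
      "\<And>n z. r n \<le> dist z x \<Longrightarrow> p n z = 0"
    by metis
  have q: "0 \<le> q n z" "q n z \<le> 1" for n z
    using unit_interval[OF pq(1-3)] by auto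
  have diam: "dist y y' \<le> 8 * C' * r n" if "3/4 < q n y" "3/4 < q n y'" for n y y'
    using peak_set_diameter[OF pq(1-3,5) r that] .
  have meet: "\<exists>y. 3/4 < q m y \<and> 3/4 < q n y" for m n
  proof -
    obtain y where "7/4 < \<bar>1 * q m y + 1 * q n y\<bar>"
      using almost_attained[OF combine[OF pq(1) pq(1), of 1 m 1 n], of "7/4" x] pq(4) by auto
    then show ?thesis
      using q[of m y] q[of n y] by (intro exI[of _ y]) auto
  qed
  obtain s where s: "\<And>n. 3/4 < q n (s n)"
    using meet by metis
  have lim0: "(\<lambda>n. 8 * C' * r n) \<longlonglongrightarrow> 0"
    using tendsto_mult_right_zero[OF r0] by auto
  have cauchy: "dist (s m) (s n) \<le> 8 * C' * r m + 8 * C' * r n" for m n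
  proof -
    obtain y where "3/4 < q m y" "3/4 < q n y" using meet by blast
    then show ?thesis
      using diam[OF s[of m], of y] diam[OF s[of n], of y] dist_triangle2[of "s m" "s n" y] by simp
  qed
  have "Cauchy s"
  proof (rule metric_CauchyI)
    fix e :: real assume "0 < e"
    then obtain N where "\<And>n. n \<ge> N \<Longrightarrow> \<bar>8 * C' * r n\<bar> < e/2"
      using LIMSEQ_D[OF lim0, of "e/2"] by auto
    then show "\<exists>N. \<forall>m\<ge>N. \<forall>n\<ge>N. dist (s m) (s n) < e"
      using cauchy by (smt (verit, best) field_sum_of_halves)
  qed
  then obtain y where y: "s \<longlonglongrightarrow> y"
    using Cauchy_convergent convergent_def by blast
  have "f x \<le> g y" if fg: "R f g" for f g
  proof -
    obtain M0 where "\<And>x. \<bar>f x\<bar> \<le> M0"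
      using bounded_dom[OF dom[OF fg]] by (auto simp: bounded_iff)
    then obtain M where M: "\<And>x. \<bar>f x\<bar> \<le> M" "1 \<le> M"
      by (meson max.cobounded1 max.cobounded2 order_trans)
    have gM: "\<bar>g z\<bar> \<le> M" for z
      using bound_iff[OF fg] M(1) by blast
    have "\<exists>z. f x - r n < g z \<and> 3/4 < q n z" for n
    proof -
      have r1: "r n \<le> 1" by (simp add: r_def)
      \<comment> \<open>The weight 16 is large enough: \<open>f x\<close>, \<open>g z\<close> and
        \<open>r n\<close> account for at most \<open>3 * M\<close>, so the sum is positive at
        \<open>z\<close> and \<open>q n z\<close> is above \<open>13/16\<close>. Then
        \<open>q n z \<le> 1\<close> gives \<open>g z > f x - r n\<close>.\<close>
      obtain z where z: "f x + 16 * M - r n < \<bar>1 * g z + 16 * M * q n z\<bar>"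
        using almost_attained[OF combine[OF fg pq(1), of 1 "16 * M" n], of "f x + 16 * M - r n" x] pq(4) r[of n]
        by auto
      have Mq: "0 \<le> M * q n z" "M * q n z \<le> M"
        using q[of n z] M(2) by (auto intro: mult_left_le)
      have "f x + 16 * M - r n < g z + 16 * (M * q n z)"
        using z gM[of z] M(1)[of x] M(2) Mq r1 by (auto simp: abs_le_iff abs_if split: if_splits)
      then have "f x - r n < g z" "M * (3/4) < M * q n z"
        using gM[of z] M(1)[of x] M(2) Mq r1 unfolding abs_le_iff by linarith+
      then show ?thesis using M(2) by auto
    qed
    then obtain t where t: "\<And>n. f x - r n < g (t n)" "\<And>n. 3/4 < q n (t n)"
      by metis
    have "(\<lambda>n. dist (t n) (s n)) \<longlonglongrightarrow> 0"
      by (rule tendsto_sandwich[OF _ _ tendsto_const lim0]) (use diam[OF t(2) s] in auto)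
    then have "t \<longlonglongrightarrow> y"
      by (intro Lim_transform[OF y]) (simp add: dist_norm tendsto_norm_zero_iff)
    moreover have "isCont g y"
      using lipschitz_ran[OF ran[OF fg]] lipschitz_on_continuous_on continuous_on_eq_continuous_at open_UNIV
      by blast
    ultimately have gt: "(\<lambda>n. g (t n)) \<longlonglongrightarrow> g y"
      by (rule isCont_tendsto_compose[rotated])
    have "(\<lambda>n. f x - r n) \<longlonglongrightarrow> f x"
      using tendsto_diff[OF tendsto_const r0, of "f x"] by simp
    then show ?thesis
      using gt by (rule LIMSEQ_le) (use t(1) less_imp_le in blast)
  qed
  then show ?thesis by blast
qed

text \<open>The one-sided inequality, applied to a function and to its negative, gives
  equality.\<close>

lemma ex_point_map: "\<exists>S. \<forall>f g x. R f g \<longrightarrow> g (S x) = f x"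
proof -
  obtain S where S: "\<And>x f g. R f g \<Longrightarrow> f x \<le> g (S x)"
    using ex_image_point by metis
  have "g (S x) = f x" if "R f g" for f g x
    using S[OF that, of x] S[OF combine[OF that that, of "-1" 0], of x] by simp
  then show ?thesis by blast
qed

text \<open>Bumps separate points, so the point maps obtained in the two directions are inverse to
  each other.\<close>

lemma point_map_bij:
  obtains S where "bij S" "\<And>f g x. R f g \<Longrightarrow> g (S x) = f x"
proof -
  interpret swapped: isometric_correspondence "\<lambda>g f. R f g" B A C' C by (rule swap)
  obtain S where S: "\<And>f g x. R f g \<Longrightarrow> g (S x) = f x" using ex_point_map by blast
  obtain T where T: "\<And>f g y. R f g \<Longrightarrow> f (T y) = g y" using swapped.ex_point_map by blast
  have sepA: "x = x'" if "\<And>f. f \<in> A \<Longrightarrow> f x = f x'" for x x'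
  proof (rule ccontr)
    assume "x \<noteq> x'"
    then obtain f where f: "f \<in> A" "f x' = 1" "f x = 0"
      using has_bumpsE[OF bumps_dom, of "dist x x'" x'] by (metis zero_less_dist_iff order_refl)
    then show False using that[OF f(1)] by simp
  qed
  have sepB: "y = y'" if "\<And>g. g \<in> B \<Longrightarrow> g y = g y'" for y y'
  proof (rule ccontr)
    assume "y \<noteq> y'"
    then obtain g where g: "g \<in> B" "g y' = 1" "g y = 0"
      using has_bumpsE[OF bumps_ran, of "dist y y'" y'] by (metis zero_less_dist_iff order_refl)
    then show False using that[OF g(1)] by simp
  qed
  have "T (S x) = x" for x
    by (rule sepA) (use S T total in metis)
  moreover have "S (T y) = y" for y
    by (rule sepB) (use S T surj in metis)
  ultimately have "bij S" by (intro bij_betw_byWitness[where f' = T]) auto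
  then show ?thesis using S that by blast
qed

text \<open>A truncated norming functional of \<open>S x - S x'\<close> is pulled back to a function
  that is still 1-Lipschitz, whose values at \<open>x\<close> and \<open>x'\<close> differ by
  \<open>k * sin (d / k)\<close>; then \<open>k\<close> tends to infinity.\<close>

lemma point_map_nonexpansive:
  assumes "CbF \<subseteq> B" and S: "\<And>f g x. R f g \<Longrightarrow> g (S x) = f x"
  shows "dist (S x) (S x') \<le> dist x x'"
proof -
  define d where "d = dist (S x) (S x')"
  obtain l where l: "linear l" "\<And>y. \<bar>l y\<bar> \<le> norm y" "l (S x - S x') = norm (S x - S x')"
    using norming_functional by blast
  have "k * sin (d / k) \<le> dist x x'" if "0 < k" for k
  proof -
    define g where "g y = k * sin ((l y - l (S x')) / k)" for y
    have "g \<in> CbF" and g: "1-lipschitz_on UNIV g"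
      unfolding g_def using sin_functional_CbF[OF l(1,2) that] by auto
    then obtain f where f: "R f g" using surj assms(1) by blast
    have "k * sin (d / k) = g (S x) - g (S x')"
      using l(3) by (simp add: g_def d_def dist_norm linear_diff[OF l(1)])
    also have "\<dots> = f x - f x'"
      by (simp add: S[OF f])
    also have "\<dots> \<le> 1 * dist x x'"
      using lipschitz_onD[of 1 UNIV f x x'] g lipschitz_iff[OF f] by (simp add: dist_real_def)
    finally show ?thesis by simp
  qed
  \<comment> \<open>With \<open>k = 1 / h\<close> the limit is the derivative of
    \<open>sin (d * h)\<close> at \<open>h = 0\<close>, which is \<open>d\<close>.\<close>
  from this[of "1 / h" for h] have "\<forall>\<^sub>F h in at_right 0. sin (d * h) / h \<le> dist x x'"
    by (intro eventually_at_rightI[of 0 1]) (auto simp: mult.commute)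
  moreover have "((\<lambda>h. sin (d * h)) has_real_derivative d) (at 0)"
    by (auto intro!: derivative_eq_intros)
  then have "((\<lambda>h. sin (d * h) / h) \<longlongrightarrow> d) (at_right 0)"
    by (auto simp: DERIV_def intro: tendsto_mono[OF at_le])
  ultimately show ?thesis
    unfolding d_def by (intro tendsto_upperbound) auto
qed

end

subsection \<open>Gateaux smooth functions in infinite dimension\<close>

text \<open>Bumps of height \<open>2\<^sup>-\<^sup>n\<close> at \<open>2\<^sup>-\<^sup>n e\<^sub>n\<close>, where the unit vectors \<open>e\<^sub>n\<close> are separated: a ray
  from the origin meets the supports of at most one of them, so their sum has Gateaux derivative
  zero at the origin, but it is not small compared to the norm.\<close>

lemma ex_CbG_not_CbF:
  assumes bumps: "has_bumps (CbG :: ('a::real_normed_vector \<Rightarrow> real) set) C"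
    and inf: "\<not> finite_dimensional TYPE('a::real_normed_vector)"
  shows "\<exists>f. f \<in> (CbG :: ('a \<Rightarrow> real) set) \<and> f \<notin> CbF"
proof -
  obtain e :: "nat \<Rightarrow> 'a" where e: "\<And>n. norm (e n) = 1" "\<And>m n. m \<noteq> n \<Longrightarrow> 1/2 \<le> norm (e m - e n)"
    using infinite_dimensional_separated_sequence[OF inf] by blast
  define t :: "nat \<Rightarrow> real" where "t n = (1/2) ^ n" for n
  have t: "0 < t n" for n by (simp add: t_def)
  have t_le: "2 * t n \<le> t m" if "m < n" for m n
  proof -
    have "t n \<le> t (Suc m)" unfolding t_def using that by (intro power_decreasing) auto
    then show ?thesis by (simp add: t_def)
  qed
  have t0: "t \<longlonglongrightarrow> 0" unfolding t_def by (rule LIMSEQ_realpow_zero) auto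
  \<comment> \<open>Radius \<open>t n / 8\<close> keeps the support in the shell between
    \<open>7/8 * t n\<close> and \<open>9/8 * t n\<close>. These shells are disjoint because the
    \<open>t n\<close> differ at least by a factor 2. With height \<open>t n\<close> the Lipschitz
    constant is \<open>8 * C\<close> for every \<open>n\<close>.\<close>
  have "\<exists>b\<in>CbG. (\<forall>z. 0 \<le> b z \<and> b z \<le> 1) \<and> b (t n *\<^sub>R e n) = 1 \<and>
      (\<forall>z. t n / 8 \<le> dist z (t n *\<^sub>R e n) \<longrightarrow> b z = 0) \<and> (C / (t n / 8))-lipschitz_on UNIV b" for n
  proof -
    have "0 < t n / 8" using t[of n] by simp
    then show ?thesis using bumps unfolding has_bumps_def by blast
  qed
  then obtain b where b: "\<And>n. b n \<in> CbG" "\<And>n z. 0 \<le> b n z" "\<And>n z. b n z \<le> 1" "\<And>n. b n (t n *\<^sub>R e n) = 1"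
      "\<And>n z. t n / 8 \<le> dist z (t n *\<^sub>R e n) \<Longrightarrow> b n z = 0" "\<And>n. (C / (t n / 8))-lipschitz_on UNIV (b n)"
    by metis
  define p where "p n z = t n * b n z" for n z
  define K where "K = 8 * C"
  have p: "0 \<le> p n z" "p n z \<le> 1" for n z
  proof -
    have "t n \<le> 1" by (simp add: t_def power_le_one)
    then show "0 \<le> p n z" "p n z \<le> 1"
      using b(2,3)[of n z] t[of n] mult_mono[of "t n" 1 "b n z" 1] by (auto simp: p_def)
  qed
  have p_peak: "p n (t n *\<^sub>R e n) = t n" for n by (simp add: p_def b(4))
  have p_near: "dist z (t n *\<^sub>R e n) < t n / 8" if "p n z \<noteq> 0" for n z
    using that b(5)[of n z] by (force simp: p_def)
  have p_lip: "\<bar>p n x - p n y\<bar> \<le> K * dist x y" for n x y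
  proof -
    have "\<bar>p n x - p n y\<bar> = t n * \<bar>b n x - b n y\<bar>"
      using t[of n] by (simp add: p_def abs_mult flip: right_diff_distrib)
    also have "\<dots> \<le> t n * (C / (t n / 8) * dist x y)"
      using lipschitz_onD[OF b(6), of x y n] t[of n] by (intro mult_left_mono) (auto simp: dist_real_def)
    also have "\<dots> = K * dist x y" using t[of n] by (simp add: K_def)
    finally show ?thesis .
  qed
  have p_gateaux: "has_gateaux_derivative (p n) (\<lambda>h. t n * gateaux_derivative (b n) x h + 0 * gateaux_derivative (b n) x h) x" for n x
    using has_gateaux_derivative_linear_combination[OF CbG_has_derivative CbG_has_derivative, OF b(1)[of n] b(1)[of n], where a = "t n" and b = 0 and x = x]
    by (simp add: p_def[abs_def])
  have p_norm: "7/8 * t n < norm z" "norm z < 9/8 * t n" if "p n z \<noteq> 0" for n z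
    using p_near[OF that] norm_triangle_ineq2[of z "t n *\<^sub>R e n"] norm_triangle_ineq3[of "t n *\<^sub>R e n" z] t[of n] e(1)[of n]
    by (auto simp: dist_norm norm_minus_commute)
  have unique: "m = n" if "p m z \<noteq> 0" "p n z \<noteq> 0" for m n z
    using p_norm[OF that(1)] p_norm[OF that(2)] t_le[of m n] t_le[of n m] t[of n] t[of m]
    by (cases m n rule: linorder_cases) auto
  define f where "f z = (\<Sum>n. p n z)" for z
  have f_sum: "f z = (\<Sum>n\<in>N. p n z)" if "finite N" "\<And>n. n \<notin> N \<Longrightarrow> p n z = 0" for N z
    unfolding f_def using that by (rule suminf_finite)
  have f_single: "\<exists>n. f z = p n z \<and> (\<forall>m. m \<noteq> n \<longrightarrow> p m z = 0)" for z
  proof -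
    obtain n where n: "\<And>m. m \<noteq> n \<Longrightarrow> p m z = 0" using unique[of _ z] by metis
    then have "f z = p n z" using f_sum[of "{n}" z] by simp
    with n show ?thesis by blast
  qed
  have f0: "f 0 = 0"
    using f_single[of 0] p_norm(1)[of _ 0] t by (metis less_le_not_le mult_pos_pos norm_zero zero_less_divide_iff zero_less_numeral)
  have f_range: "0 \<le> f z" "f z \<le> 1" for z
    using f_single[of z] p by auto
  then have "bounded (range f)" by (auto simp: bounded_iff intro!: exI[of _ 1])
  moreover have "K-lipschitz_on UNIV f"
  proof (rule lipschitz_onI)
    have "0 \<le> C / (t 0 / 8)" using b(6) by (rule lipschitz_on_nonneg)
    then show K0: "0 \<le> K" by (simp add: K_def t_def)
    fix x y
    obtain m where m: "f x = p m x" "\<And>k. k \<noteq> m \<Longrightarrow> p k x = 0" using f_single[of x] by blast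
    obtain n where n: "f y = p n y" "\<And>k. k \<noteq> n \<Longrightarrow> p k y = 0" using f_single[of y] by blast
    \<comment> \<open>For different indices \<open>p m\<close> vanishes at \<open>y\<close> and
      \<open>p n\<close> at \<open>x\<close>. The values are nonnegative, so their difference is at
      most the larger one, which a single bump controls.\<close>
    have "\<bar>f x - f y\<bar> \<le> K * dist x y"
    proof (cases "m = n")
      case True
      then show ?thesis using p_lip[of n x y] m n by simp
    next
      case False
      then show ?thesis
        using p_lip[of m x y] p_lip[of n x y] m(1) n(1) m(2)[of n] n(2)[of m] p(1)[of m x] p(1)[of n y]
        by (auto simp: abs_le_iff)
    qed
    then show "dist (f x) (f y) \<le> K * dist x y" by (simp add: dist_real_def)
  qed
  moreover have "gateaux_differentiable f x" if x: "x \<noteq> 0" for x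
  proof -
    \<comment> \<open>Away from the origin the sum is locally finite: for such \<open>n\<close> the
      support lies in norm below \<open>norm x / 2\<close>.\<close>
    have "\<forall>\<^sub>F n in sequentially. t n < norm x / 4"
      using x by (intro order_tendstoD(2)[OF t0]) simp
    then obtain N where N: "\<And>n. n \<ge> N \<Longrightarrow> t n < norm x / 4"
      by (auto simp: eventually_sequentially)
    have "f z = (\<Sum>n<N. p n z)" if "norm x / 2 < norm z" for z
    proof (rule f_sum)
      fix n assume "n \<notin> {..<N}"
      then show "p n z = 0"
        using N[of n] p_norm(2)[of n z] that norm_ge_zero[of x] by (cases "p n z = 0") auto
    qed simp
    moreover have "\<forall>\<^sub>F z in nhds x. norm x / 2 < norm z"
      using x by (intro order_tendstoD(1)[of norm "norm x"] tendsto_norm filterlim_ident) simp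
    ultimately have "\<forall>\<^sub>F z in nhds x. (\<Sum>n<N. p n z) = f z"
      by (auto elim: eventually_mono)
    with has_gateaux_derivative_sum[OF p_gateaux]
    have "has_gateaux_derivative f (\<lambda>h. \<Sum>n<N. t n * gateaux_derivative (b n) x h + 0 * gateaux_derivative (b n) x h) x"
      by (rule has_gateaux_derivative_cong_eventually)
    then show ?thesis by (auto simp: gateaux_differentiable_def)
  qed
  moreover have zero: "has_gateaux_derivative f (\<lambda>_. 0) 0"
  proof -
    have ray: "\<forall>\<^sub>F s in at_right 0. f (s *\<^sub>R h) = 0" for h
    proof (cases "h = 0")
      case False
      define u where "u = h /\<^sub>R norm h"
      \<comment> \<open>Passing from the point to its direction adds two errors below
        \<open>1/8\<close>, the offset from the centre and the radial error. Directions within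
        \<open>1/4\<close> of two different \<open>e n\<close> are excluded by their separation
        \<open>1/2\<close>.\<close>
      have near: "norm (u - e n) < 1/4" if "0 < s" "p n (s *\<^sub>R h) \<noteq> 0" for s n
      proof -
        define c where "c = s * norm h"
        have hu: "s *\<^sub>R h = c *\<^sub>R u" and u1: "norm u = 1" and c: "0 < c"
          using False that by (auto simp: u_def c_def)
        have d: "norm (c *\<^sub>R u - t n *\<^sub>R e n) < t n / 8"
          using p_near[OF that(2)] by (simp add: dist_norm hu)
        have ct: "\<bar>c - t n\<bar> < t n / 8"
          using d norm_triangle_ineq3[of "c *\<^sub>R u" "t n *\<^sub>R e n"] c t[of n] e(1) u1 by simp
        have "t n *\<^sub>R (u - e n) = (t n - c) *\<^sub>R u + (c *\<^sub>R u - t n *\<^sub>R e n)"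
          by (simp add: algebra_simps)
        then have "norm (t n *\<^sub>R (u - e n)) \<le> norm ((t n - c) *\<^sub>R u) + norm (c *\<^sub>R u - t n *\<^sub>R e n)"
          by (metis norm_triangle_ineq)
        also have "norm ((t n - c) *\<^sub>R u) = \<bar>c - t n\<bar>"
          using u1 by (simp add: abs_minus_commute)
        finally have "norm (t n *\<^sub>R (u - e n)) < t n * (1/4)"
          using ct d by linarith
        then show ?thesis using t[of n] by simp
      qed
      show ?thesis
      proof (cases "\<exists>n. norm (u - e n) < 1/4")
        case True
        then obtain n where n: "norm (u - e n) < 1/4" by blast
        have m: "m = n" if "norm (u - e m) < 1/4" for m
        proof (rule ccontr)
          assume "m \<noteq> n"
          then show False
            using e(2)[of m n] that n norm_triangle_ineq4[of "u - e n" "u - e m"] by simp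
        qed
        have "f (s *\<^sub>R h) = 0" if s: "0 < s" "s < 7/8 * t n / norm h" for s
        proof -
          have "p k (s *\<^sub>R h) = 0" for k
          proof (rule ccontr)
            assume k: "p k (s *\<^sub>R h) \<noteq> 0"
            then have "k = n" using near s(1) m by blast
            then show False
              using p_norm(1)[OF k] s False by (simp add: pos_less_divide_eq)
          qed
          then show ?thesis by (simp add: f_def)
        qed
        moreover have "0 < 7/8 * t n / norm h" using False t[of n] by simp
        ultimately show ?thesis
          by (auto simp: eventually_at_right_field)
      next
        case none: False
        have "f (s *\<^sub>R h) = 0" if "0 < s" for s
          using near[OF that] none f_single[of "s *\<^sub>R h"] by metis
        then show ?thesis by (auto simp: eventually_at_right_field intro: exI[of _ 1])
      qed
    qed (simp add: f0)
    have "\<forall>\<^sub>F s in at 0. (f (0 + s *\<^sub>R h) - f 0) /\<^sub>R s = 0" for h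
    proof -
      \<comment> \<open>Negative parameters run along the opposite ray, which may meet a different
        bump.\<close>
      have "\<forall>\<^sub>F s in at_left 0. f (s *\<^sub>R h) = 0"
        using ray[of "- h"] by (simp add: at_left_minus[of 0] eventually_filtermap)
      then show ?thesis
        using ray[of h] by (auto simp: eventually_at_split f0 elim: eventually_mono)
    qed
    then show ?thesis
      by (simp add: has_gateaux_derivative_def tendsto_eventually)
  qed
  ultimately have "f \<in> CbG"
    unfolding CbG_def gateaux_differentiable_def by auto metis
  moreover have "f \<notin> CbF"
  proof
    assume "f \<in> CbF"
    then obtain D where D: "(f has_derivative D) (at 0)"
      by (auto simp: CbF_def differentiable_def)
    then have "D = (\<lambda>_. 0)"
      using zero gateaux_derivative_eq has_derivative_imp_has_gateaux_derivative by metis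
    then have "(f has_derivative (\<lambda>_. 0)) (at 0)" using D by simp
    \<comment> \<open>A Frechet derivative at 0 would equal the Gateaux derivative zero, but at the
      peaks \<open>f\<close> equals the norm, so the tolerance \<open>1/2\<close> already
      fails.\<close>
    then obtain d where d: "0 < d" "\<And>y. norm (y - 0) < d \<Longrightarrow> norm (f y - f 0 - 0) \<le> 1/2 * norm (y - 0)"
      unfolding has_derivative_at_alt by (metis half_gt_zero zero_less_one)
    have "\<forall>\<^sub>F n in sequentially. t n < d"
      using d(1) by (intro order_tendstoD(2)[OF t0])
    then obtain n where n: "t n < d" by (auto simp: eventually_sequentially)
    have "f (t n *\<^sub>R e n) = t n"
      using f_single[of "t n *\<^sub>R e n"] p_peak t[of n] by (metis less_irrefl)
    then show False
      using f0 d(2)[of "t n *\<^sub>R e n"] n t[of n] e(1)[of n] by simp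
  qed
  ultimately show ?thesis by blast
qed

subsection \<open>Isomorphisms of the function spaces\<close>

lemma isometric_isomorphism_bounded_linear:
  assumes "isometric_isomorphism T" shows "bounded_linear T"
  using assms unfolding isometric_isomorphism_def
  by (intro bounded_linear_intro[of T 1]) (auto simp: linear_add linear_cmul)

lemma isometric_isomorphism_inv:
  assumes T: "isometric_isomorphism T" shows "isometric_isomorphism (inv T)"
proof -
  have lin: "linear T" and bij: "bij T" and norm: "\<And>x. norm (T x) = norm x"
    using T by (auto simp: isometric_isomorphism_def)
  have TT: "T (inv T y) = y" for y using bij by (simp add: bij_is_surj surj_f_inv_f)
  have "linear (inv T)"
    by (rule linearI; rule injD[OF bij_is_inj[OF bij]]) (simp_all add: TT linear_add[OF lin] linear_cmul[OF lin])
  moreover have "norm (inv T y) = norm y" for y using norm[of "inv T y"] by (simp add: TT)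
  ultimately show ?thesis by (simp add: isometric_isomorphism_def bij_imp_bij_inv[OF bij])
qed

lemma isometric_isomorphism_dist:
  assumes "isometric_isomorphism T" shows "dist (T x) (T y) = dist x y"
  using assms by (simp add: isometric_isomorphism_def dist_norm flip: linear_diff)

lemma CbF_compose_isometric_isomorphism:
  assumes f: "f \<in> CbF" and T: "isometric_isomorphism T"
  shows "(\<lambda>x. f (T x)) \<in> CbF"
proof -
  have "bounded (range (\<lambda>x. f (T x)))"
    by (rule bounded_subset[of "range f"]) (use f in \<open>auto simp: CbF_def\<close>)
  moreover obtain L where L: "L-lipschitz_on UNIV f" using f by (auto simp: CbF_def)
  then have "L-lipschitz_on UNIV (\<lambda>x. f (T x))"
    using lipschitz_onD[OF L] lipschitz_on_nonneg[OF L]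
    by (intro lipschitz_onI) (auto simp flip: isometric_isomorphism_dist[OF T])
  moreover have "(\<lambda>x. f (T x)) differentiable (at x)" for x
    using f differentiable_chain_at[of T x f]
      bounded_linear_imp_differentiable[OF isometric_isomorphism_bounded_linear[OF T]]
    by (simp add: CbF_def o_def)
  ultimately show ?thesis unfolding CbF_def by blast
qed

lemma CbG_const: "(\<lambda>_. c) \<in> CbG"
proof -
  have "(\<lambda>_::'a. c) \<in> CbF"
    unfolding CbF_def using lipschitz_on_constant[of UNIV c] by auto
  then show ?thesis using CbF_subset_CbG by blast
qed

lemma isometric_isomorphism_imp_function_space_isomorphism:
  fixes T :: "'a::real_normed_vector \<Rightarrow> 'b::real_normed_vector"
  assumes T: "isometric_isomorphism T" and fin: "finite_dimensional TYPE('a)"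
  shows "\<exists>\<Phi> :: ('a \<Rightarrow> real) \<Rightarrow> ('b \<Rightarrow> real).
    function_space_isomorphism CbG CbG_norm CbF CbF_norm \<Phi> \<and>
    (\<forall>f\<in>CbG. sup_norm (\<Phi> f) = sup_norm f \<and> frechet_deriv_norm (\<Phi> f) = gateaux_deriv_norm f)"
proof -
  define \<Phi> :: "('a \<Rightarrow> real) \<Rightarrow> ('b \<Rightarrow> real)" where "\<Phi> f = (\<lambda>y. f (inv T y))" for f
  have bij: "bij T" using T by (simp add: isometric_isomorphism_def)
  have TT: "T (inv T y) = y" "inv T (T x) = x" for x y
    using bij by (simp_all add: bij_is_surj surj_f_inv_f bij_is_inj)
  have eq: "(CbG :: ('a \<Rightarrow> real) set) = CbF"
    by (intro CbG_eq_CbF_if_compact_cball finite_dimensional_imp_compact_cball fin)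
  have \<Phi>: "\<Phi> f \<in> CbF" if "f \<in> CbG" for f
    using that unfolding \<Phi>_def eq by (rule CbF_compose_isometric_isomorphism[OF _ isometric_isomorphism_inv[OF T]])
  have bb: "bij_betw \<Phi> CbG CbF"
    by (rule bij_betw_byWitness[where f' = "\<lambda>g x. g (T x)"])
       (use \<Phi> CbF_compose_isometric_isomorphism[OF _ T] in \<open>auto simp: \<Phi>_def TT eq\<close>)
  have sup: "sup_norm (\<Phi> f) = sup_norm f" for f
  proof -
    have "range (inv T) = UNIV" using bij bij_imp_bij_inv bij_is_surj by blast
    then show ?thesis
      unfolding sup_norm_def \<Phi>_def by (metis image_image)
  qed
  have der: "frechet_deriv_norm (\<Phi> f) = gateaux_deriv_norm f" if f: "f \<in> CbG" for f
  proof -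
    have g: "\<Phi> f \<in> CbG" using \<Phi>[OF f] CbF_subset_CbG by blast
    have "dist (f x) (f y) = dist (\<Phi> f (T x)) (\<Phi> f (T y))" for x y
      by (simp add: \<Phi>_def TT)
    moreover have "dist (\<Phi> f x) (\<Phi> f y) = dist (f (inv T x)) (f (inv T y))" for x y
      by (simp add: \<Phi>_def)
    \<comment> \<open>The derivative norms are compared through their nonnegative upper bounds,
      which are Lipschitz constants and are invariant under isometries.\<close>
    ultimately have "K-lipschitz_on UNIV (\<Phi> f) \<longleftrightarrow> K-lipschitz_on UNIV f" for K
      unfolding lipschitz_on_def
      by (metis UNIV_I isometric_isomorphism_dist[OF T] TT(1))
    then have "gateaux_deriv_norm (\<Phi> f) \<le> K \<longleftrightarrow> gateaux_deriv_norm f \<le> K" if "0 \<le> K" for K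
      using CbG_deriv_norm_le_iff[OF f that] CbG_deriv_norm_le_iff[OF g that] by simp
    then have "gateaux_deriv_norm (\<Phi> f) = gateaux_deriv_norm f"
      using gateaux_deriv_norm_nonneg[OF f] gateaux_deriv_norm_nonneg[OF g] by (meson order_antisym order_refl)
    then show ?thesis using CbF_deriv_norm[OF \<Phi>[OF f]] by simp
  qed
  have norm: "CbF_norm (\<Phi> f) = CbG_norm f" if "f \<in> CbG" for f
    using that by (simp add: CbF_norm_def CbG_norm_def sup der)
  have "function_space_isomorphism CbG CbG_norm CbF CbF_norm \<Phi>"
    unfolding function_space_isomorphism_def
    using bb norm by (auto simp: \<Phi>_def intro!: exI[of _ 1])
  with sup der show ?thesis by blast
qed

lemma finite_dimensional_linear_surj:
  fixes T :: "'a::real_vector \<Rightarrow> 'b::real_vector"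
  assumes "linear T" "surj T" "finite_dimensional TYPE('a)"
  shows "finite_dimensional TYPE('b)"
proof -
  obtain B :: "'a set" where "finite B" "span B = UNIV"
    using assms(3) by (auto simp: finite_dimensional_def)
  then have "finite (T ` B)" "span (T ` B) = UNIV"
    using assms(1,2) by (simp_all add: linear_span_image)
  then show ?thesis unfolding finite_dimensional_def by blast
qed

section \<open>Consequences of an isomorphism preserving both norms\<close>

context
  fixes \<Phi> :: "('a::banach \<Rightarrow> real) \<Rightarrow> ('b::banach \<Rightarrow> real)"
  assumes iso: "function_space_isomorphism CbG CbG_norm CbF CbF_norm \<Phi>"
    and norms: "\<And>f. f \<in> CbG \<Longrightarrow> sup_norm (\<Phi> f) = sup_norm f"
      "\<And>f. f \<in> CbG \<Longrightarrow> frechet_deriv_norm (\<Phi> f) = gateaux_deriv_norm f"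
begin

lemma isomorphism_image: "f \<in> CbG \<Longrightarrow> \<Phi> f \<in> CbF"
  using iso by (auto simp: function_space_isomorphism_def bij_betw_def)

lemma isomorphism_lipschitz_iff:
  assumes f: "f \<in> CbG" shows "K-lipschitz_on UNIV (\<Phi> f) \<longleftrightarrow> K-lipschitz_on UNIV f"
proof (cases "0 \<le> K")
  case True
  have "\<Phi> f \<in> CbG" using isomorphism_image[OF f] CbF_subset_CbG by blast
  then show ?thesis
    using CbG_deriv_norm_le_iff[OF f True] CbG_deriv_norm_le_iff[OF _ True, of "\<Phi> f"] norms(2)[OF f]
      CbF_deriv_norm[OF isomorphism_image[OF f]] by simp
qed (auto dest: lipschitz_on_nonneg)

lemma isomorphism_bound_iff:
  assumes f: "f \<in> CbG" shows "(\<forall>y. \<bar>\<Phi> f y\<bar> \<le> M) \<longleftrightarrow> (\<forall>x. \<bar>f x\<bar> \<le> M)"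
  using f isomorphism_image[OF f] norms(1)[OF f] sup_norm_le_iff[of f M] sup_norm_le_iff[of "\<Phi> f" M]
  by (simp add: CbG_def CbF_def)

lemma isomorphism_linear:
  assumes "f \<in> CbG" "g \<in> CbG"
  shows "\<Phi> (\<lambda>x. a * f x + b * g x) = (\<lambda>y. a * \<Phi> f y + b * \<Phi> g y)"
proof -
  have "(\<lambda>x. a * f x) \<in> CbG" "(\<lambda>x. b * g x) \<in> CbG"
    using CbG_linear_combination[OF assms, of a 0] CbG_linear_combination[OF assms, of 0 b] by simp_all
  then show ?thesis
    using iso assms unfolding function_space_isomorphism_def by simp
qed

lemma isomorphism_scale: "f \<in> CbG \<Longrightarrow> \<Phi> (\<lambda>x. a * f x) = (\<lambda>y. a * \<Phi> f y)"
  using iso by (simp add: function_space_isomorphism_def)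

text \<open>The constant one has derivative norm zero, so its image is 0-Lipschitz and hence
  constant; the sup norm fixes its absolute value.\<close>

lemma isomorphism_one: "\<exists>c. \<bar>c\<bar> = 1 \<and> \<Phi> (\<lambda>_. 1) = (\<lambda>_. c)"
proof -
  define g where "g = \<Phi> (\<lambda>_. 1)"
  have "0-lipschitz_on UNIV g"
    unfolding g_def by (subst isomorphism_lipschitz_iff) (auto simp: CbG_const lipschitz_on_def)
  then have "dist (g y) (g 0) \<le> 0 * dist y 0" for y
    by (rule lipschitz_onD) auto
  then have g: "g = (\<lambda>_. g 0)" by auto
  have "(\<forall>y::'b. \<bar>g 0\<bar> \<le> M) \<longleftrightarrow> (1::real) \<le> M" for M
    using isomorphism_bound_iff[OF CbG_const, of 1 M] g unfolding g_def[symmetric] by (metis abs_one)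
  then have "\<bar>g 0\<bar> = 1"
    by (metis order_antisym order_refl)
  then show ?thesis using g unfolding g_def by blast
qed

text \<open>Multiplying by the sign \<open>c\<close> makes the map unital, since
  \<open>c * c = 1\<close>, and changes neither norm.\<close>

lemma isomorphism_correspondence:
  assumes bumps: "has_bumps (CbG :: ('a \<Rightarrow> real) set) C" "has_bumps (CbF :: ('b \<Rightarrow> real) set) C'"
  obtains c where "isometric_correspondence (\<lambda>f g. f \<in> CbG \<and> g = (\<lambda>y. c * \<Phi> f y)) CbG CbF C C'"
proof -
  obtain c where c: "\<bar>c\<bar> = 1" "\<Phi> (\<lambda>_. 1) = (\<lambda>_. c)" using isomorphism_one by blast
  then have cc: "c * c = 1" by (metis abs_mult_self_eq mult_1)
  have scale: "(\<lambda>x. c * f x) \<in> CbG" if "f \<in> CbG" for f :: "'a \<Rightarrow> real"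
    using CbG_linear_combination[OF that that, of c 0] by simp
  have surj: "\<exists>f\<in>CbG. g = (\<lambda>y. c * \<Phi> f y)" if "g \<in> CbF" for g
  proof -
    have "\<Phi> ` CbG = CbF"
      using iso by (simp add: function_space_isomorphism_def bij_betw_def)
    then have "g \<in> \<Phi> ` CbG" using \<open>g \<in> CbF\<close> by simp
    then obtain f where f: "f \<in> CbG" "\<Phi> f = g" by blast
    then have "g = (\<lambda>y. c * \<Phi> (\<lambda>x. c * f x) y)"
      using cc by (simp add: isomorphism_scale flip: mult.assoc)
    with scale[OF f(1)] show ?thesis by blast
  qed
  have ran: "(\<lambda>y. c * \<Phi> f y) \<in> CbF" if "f \<in> CbG" for f
    using isomorphism_image[OF scale[OF that]] isomorphism_scale[OF that] by simp
  have lip: "K-lipschitz_on UNIV (\<lambda>y. c * \<Phi> f y) \<longleftrightarrow> K-lipschitz_on UNIV f" if "f \<in> CbG" for f K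
  proof -
    have "dist (c * s) (c * t) = dist s t" for s t
      using c(1) by (simp add: dist_real_def abs_mult flip: right_diff_distrib)
    then show ?thesis
      using isomorphism_lipschitz_iff[OF that, of K] by (simp add: lipschitz_on_def)
  qed
  have "isometric_correspondence (\<lambda>f g. f \<in> CbG \<and> g = (\<lambda>y. c * \<Phi> f y)) CbG CbF C C'"
  proof (unfold_locales, goal_cases)
    case (5 f)
    then show ?case by (simp add: CbG_def)
  next
    case (6 g)
    then show ?case by (simp add: CbF_def)
  next
    case (7 g)
    then show ?case by (simp add: CbF_def)
  next
    case (8 f)
    then show ?case by (simp add: CbG_def)
  next
    case (12 f g f' g' a b)
    then show ?case
      using CbG_linear_combination[of f f' a b] by (auto simp: isomorphism_linear algebra_simps)
  next
    case (13 f g M)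
    then show ?case
      using isomorphism_bound_iff[of f M] c(1) by (simp add: abs_mult)
  next
    case (14 f g K)
    then show ?case using lip by simp
  qed (use surj ran bumps cc c(2) CbG_const in auto)
  then show ?thesis by (rule that)
qed

lemma isomorphism_imp_isometric_isomorphism:
  assumes bumps: "has_bumps (CbG :: ('a \<Rightarrow> real) set) C" "has_bumps (CbF :: ('b \<Rightarrow> real) set) C'"
  shows "(\<exists>T :: 'a \<Rightarrow> 'b. isometric_isomorphism T) \<and> finite_dimensional TYPE('a)"
proof -
  obtain c where "isometric_correspondence (\<lambda>f g. f \<in> CbG \<and> g = (\<lambda>y. c * \<Phi> f y)) CbG CbF C C'"
    using isomorphism_correspondence[OF bumps] by blast
  then interpret isometric_correspondence "\<lambda>f g. f \<in> CbG \<and> g = (\<lambda>y. c * \<Phi> f y)" CbG CbF C C' .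
  interpret swapped: isometric_correspondence "\<lambda>g f. f \<in> CbG \<and> g = (\<lambda>y. c * \<Phi> f y)" CbF CbG C' C
    by (rule swap)
  obtain S where S: "bij S" "\<And>f g x. f \<in> CbG \<and> g = (\<lambda>y. c * \<Phi> f y) \<Longrightarrow> g (S x) = f x"
    using point_map_bij by blast
  have SS: "S (inv S y) = y" "inv S (S x) = x" for x y
    using S(1) by (simp_all add: bij_is_surj surj_f_inv_f bij_is_inj)
  have inv: "f (inv S y) = g y" if "f \<in> CbG \<and> g = (\<lambda>y. c * \<Phi> f y)" for f g y
    using S(2)[OF that, of "inv S y"] by (simp add: SS)
  have "dist (S x) (S x') \<le> dist x x'" for x x'
    by (rule point_map_nonexpansive[where S = S, OF order_refl]) (use S(2) in blast)
  moreover have "dist (inv S y) (inv S y') \<le> dist y y'" for y y'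
    by (rule swapped.point_map_nonexpansive[where S = "inv S", OF CbF_subset_CbG]) (use inv in blast)
  from this[of "S x" "S x'" for x x'] have "dist x x' \<le> dist (S x) (S x')" for x x'
    by (simp add: SS)
  ultimately have dist: "dist (S x) (S x') = dist x x'" for x x'
    by (rule order_antisym)
  define T where "T x = S x - S 0" for x
  have "bij T"
    by (rule bij_betw_byWitness[where f' = "\<lambda>y. inv S (y + S 0)"]) (auto simp: T_def SS)
  moreover have dT: "dist (T x) (T y) = dist x y" for x y
    using dist[of x y] by (simp add: T_def dist_norm)
  moreover have T0: "T 0 = 0" by (simp add: T_def)
  ultimately have lin: "linear T" by (rule mazur_ulam)
  moreover have "norm (T x) = norm x" for x
    using dT[of x 0] T0 by simp
  ultimately have T: "isometric_isomorphism T"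
    using \<open>bij T\<close> by (simp add: isometric_isomorphism_def)
  have "finite_dimensional TYPE('a)"
  proof (rule ccontr)
    assume "\<not> finite_dimensional TYPE('a)"
    then obtain f :: "'a \<Rightarrow> real" where f: "f \<in> CbG" "f \<notin> CbF"
      using ex_CbG_not_CbF[OF bumps(1)] by blast
    define g where "g = (\<lambda>y. c * \<Phi> f y)"
    have "g \<in> CbF" using ran[of f g] f(1) g_def by blast
    \<comment> \<open>Since \<open>S\<close> is \<open>T\<close> followed by a translation, the
      Frechet smoothness of \<open>g\<close> passes back to \<open>f\<close>.\<close>
    have "g (S x) = f x" for x using S(2)[of f g] f(1) g_def by blast
    then have fg: "f = (\<lambda>x. g (T x + S 0))" by (simp add: T_def)
    have "(\<lambda>x. T x + S 0) differentiable (at x)" for x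
      using bounded_linear_imp_differentiable[OF isometric_isomorphism_bounded_linear[OF T]]
      by (intro differentiable_add) auto
    moreover have "g differentiable (at y)" for y
      using \<open>g \<in> CbF\<close> by (simp add: CbF_def)
    ultimately have "f differentiable (at x)" for x
      using differentiable_chain_at[of "\<lambda>x. T x + S 0" x g] fg by (simp add: o_def)
    then show False using f by (simp add: CbG_def CbF_def)
  qed
  with T show ?thesis by blast
qed

end

theorem theorem3p12:
  assumes "\<exists>b \<in> (CbG :: ('a::banach \<Rightarrow> real) set). bump_function b"
    and "\<exists>b \<in> (CbF :: ('b::banach \<Rightarrow> real) set). bump_function b"
  shows "(\<exists>\<Phi> :: ('a \<Rightarrow> real) \<Rightarrow> ('b \<Rightarrow> real).
            function_space_isomorphism CbG CbG_norm CbF CbF_norm \<Phi> \<and>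
            (\<forall>f\<in>CbG. sup_norm (\<Phi> f) = sup_norm f \<and>
                       frechet_deriv_norm (\<Phi> f) = gateaux_deriv_norm f))
         \<longleftrightarrow>
         (\<exists>T :: 'a \<Rightarrow> 'b. isometric_isomorphism T) \<and>
         finite_dimensional TYPE('a) \<and> finite_dimensional TYPE('b)"
    (is "?iso \<longleftrightarrow> ?fin")
proof
  assume ?iso
  then obtain \<Phi> :: "('a \<Rightarrow> real) \<Rightarrow> ('b \<Rightarrow> real)" where \<Phi>:
    "function_space_isomorphism CbG CbG_norm CbF CbF_norm \<Phi>"
    "\<And>f. f \<in> CbG \<Longrightarrow> sup_norm (\<Phi> f) = sup_norm f"
    "\<And>f. f \<in> CbG \<Longrightarrow> frechet_deriv_norm (\<Phi> f) = gateaux_deriv_norm f"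
    by blast
  obtain C C' where "has_bumps (CbG :: ('a \<Rightarrow> real) set) C" "has_bumps (CbF :: ('b \<Rightarrow> real) set) C'"
    using assms CbG_has_bumps CbF_has_bumps by blast
  then obtain T :: "'a \<Rightarrow> 'b" where T: "isometric_isomorphism T" and fin: "finite_dimensional TYPE('a)"
    using isomorphism_imp_isometric_isomorphism[OF \<Phi>] by blast
  then have "finite_dimensional TYPE('b)"
    by (intro finite_dimensional_linear_surj[of T]) (auto simp: isometric_isomorphism_def bij_is_surj)
  with T fin show ?fin by blast
next
  assume ?fin
  then show ?iso using isometric_isomorphism_imp_function_space_isomorphism by blast
qed

end
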